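(* For any reduced plane curve singularity $(C,z)\subset(\mathbb{P}^2,z)$ we have $$\gamma^{\mathrm{es}}(C,z)\leq(\tau^{\mathrm{es}}(C,z)+1)^2\quad\text{and}\quad\gamma^{\mathrm{ea}}(C,z)\leq(\tau(C,z)+1)^2,$$ where $\tau(C,z)=\deg X^{\mathrm{ea}}(C,z)$ denotes the Tjurina number, while $\tau^{\mathrm{es}}(C,z)=\deg X^{\mathrm{es}}(C,z)$ is the codimension of the $\mu$-constant stratum in a versal deformation base of $(C,z)$.
   Context: $\mathbb{P}^2=\mathbb{P}^2(\mathbb{C})$. For a reduced plane curve germ $(C,z)$ with local equation $f$, $X^{\mathrm{ea}}(C,z)$ is the zero-dimensional scheme defined by the Tjurina ideal $\langle f,\partial f/\partial x,\partial f/\partial y\rangle\subset\mathcal{O}_{\mathbb{P}^2,z}$, and $X^{\mathrm{es}}(C,z)\subset X^{\mathrm{ea}}(C,z)$ is the zero-dimensional scheme defined by the equisingularity ideal $I^{\mathrm{es}}(C,z)=\{g\in\mathcal{O}_{\mathbb{P}^2,z} : f+\varepsilon g\text{ is equisingular (in the sense of Wahl) over }\mathrm{Spec}(\mathbb{C}[\varepsilon]/\varepsilon^2)\}$. For a zero-dimensional scheme $\emptyset\neq X\subset X^{\mathrm{ea}}(C,z)$ and a curve germ $(D,z)\subset(\mathbb{P}^2,z)$ without common component with $(C,z)$ put $$\Delta(C,D;X):=\min\{(C,D)_z-\deg(D\cap X),\ \deg(D\cap X)\},$$ where $(C,D)_z$ is the local intersection number (one always has $\Delta(C,D;X)\geq1$),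 and $$\gamma(C;X):=\max_{(D,z)}\Bigl\{\tfrac{(\deg(D\cap X))^2}{\Delta(C,D;X)}+2\deg(D\cap X)+\Delta(C,D;X)\Bigr\},$$ the maximum being over all curve germs $(D,z)$ having no component in common with $(C,z)$. Put $\gamma^{\mathrm{es}}(C,z):=\gamma(C;X^{\mathrm{es}}(C,z))$ and $\gamma^{\mathrm{ea}}(C,z):=\gamma(C;X^{\mathrm{ea}}(C,z))$. *)

theory Defs
  imports
    "HOL-Computational_Algebra.Computational_Algebra"
    "HOL-Library.Extended_Nat"
    "HOL-Library.Extended_Real"
begin

section \<open>The local ring of a smooth surface germ\<close>

text \<open>
  After the choice of local (for instance affine) coordinates \<open>x, y\<close> centred at \<open>z\<close>, the analytic
  local ring of the projective plane over the complex numbers at a point \<open>z\<close> is the ring of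
  convergent power series in \<open>x, y\<close>.
  In \<^typ>\<open>complex fps fps\<close> the outer variable is \<open>x\<close> and the inner one is \<open>y\<close>, so
  \<^term>\<open>f $ i $ j\<close> is the coefficient of \<open>x\<^sup>i y\<^sup>j\<close>. The geometric bound on the coefficients
  expresses absolute convergence on some neighbourhood of the origin.
\<close>

definition convergent2 :: "complex fps fps \<Rightarrow> bool" where
  "convergent2 f \<longleftrightarrow> (\<exists>M r. \<forall>i j. norm (f $ i $ j) \<le> M * r ^ (i + j))"

lemma convergent2I: "(\<And>i j. norm (f $ i $ j) \<le> M * r ^ (i + j)) \<Longrightarrow> convergent2 f"
  unfolding convergent2_def by blast

lemma convergent2_common:
  assumes "convergent2 f" "convergent2 g"
  obtains K where "K \<ge> 1" "\<And>i j. norm (f $ i $ j) \<le> K * K ^ (i + j)"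
    "\<And>i j. norm (g $ i $ j) \<le> K * K ^ (i + j)"
proof -
  obtain M r where f: "\<And>i j. norm (f $ i $ j) \<le> M * r ^ (i + j)"
    using assms(1) unfolding convergent2_def by blast
  obtain N s where g: "\<And>i j. norm (g $ i $ j) \<le> N * s ^ (i + j)"
    using assms(2) unfolding convergent2_def by blast
  define K where "K = Max {1, \<bar>M\<bar>, \<bar>r\<bar>, \<bar>N\<bar>, \<bar>s\<bar>}"
  have K: "1 \<le> K" "\<bar>M\<bar> \<le> K" "\<bar>r\<bar> \<le> K" "\<bar>N\<bar> \<le> K" "\<bar>s\<bar> \<le> K"
    unfolding K_def by (auto intro!: Max_ge simp del: Max_insert)
  have *: "a * b ^ n \<le> K * K ^ n" if "\<bar>a\<bar> \<le> K" "\<bar>b\<bar> \<le> K" for a b n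
  proof -
    have "a * b ^ n \<le> \<bar>a\<bar> * \<bar>b\<bar> ^ n" by (metis abs_ge_self abs_mult power_abs)
    also have "\<dots> \<le> K * K ^ n" using that K by (intro mult_mono power_mono) auto
    finally show ?thesis .
  qed
  show ?thesis
    by (rule that[of K]) (use K f g * order_trans in blast)+
qed

lemma convergent2_bound:
  assumes "convergent2 f"
  obtains K where "K \<ge> 1" "\<And>i j. norm (f $ i $ j) \<le> K * K ^ (i + j)"
  using convergent2_common[OF assms assms] by metis

lemma fps2_mult_nth:
  fixes f g :: "complex fps fps"
  shows "(f * g) $ i $ j = (\<Sum>a=0..i. \<Sum>b=0..j. f $ a $ b * g $ (i - a) $ (j - b))"
  by (simp add: fps_mult_nth fps_sum_nth)

lemma Suc_le_two_power: "real (Suc n) \<le> 2 ^ n"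
  by (induction n) auto

lemma convergent2_mult:
  assumes "convergent2 f" "convergent2 g"
  shows "convergent2 (f * g)"
proof -
  obtain K where K: "K \<ge> 1" and f: "\<And>i j. norm (f $ i $ j) \<le> K * K ^ (i + j)"
    and g: "\<And>i j. norm (g $ i $ j) \<le> K * K ^ (i + j)"
    using convergent2_common[OF assms] by metis
  have "norm ((f * g) $ i $ j) \<le> (K * K) * (2 * K) ^ (i + j)" for i j
  proof -
    have t: "norm (f $ a $ b * g $ (i - a) $ (j - b)) \<le> (K * K) * K ^ (i + j)"
      if "a \<in> {0..i}" "b \<in> {0..j}" for a b
    proof -
      have "norm (f $ a $ b * g $ (i - a) $ (j - b))
          \<le> (K * K ^ (a + b)) * (K * K ^ ((i - a) + (j - b)))"
        unfolding norm_mult using K by (intro mult_mono f g) auto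
      also have "\<dots> = (K * K) * K ^ ((a + b) + ((i - a) + (j - b)))"
        by (simp add: power_add mult_ac)
      also have "(a + b) + ((i - a) + (j - b)) = i + j" using that by auto
      finally show ?thesis .
    qed
    have "norm ((f * g) $ i $ j) \<le> (\<Sum>a=0..i. \<Sum>b=0..j. (K * K) * K ^ (i + j))"
      unfolding fps2_mult_nth by (intro sum_norm_le t)
    also have "\<dots> = real (Suc i) * (real (Suc j) * ((K * K) * K ^ (i + j)))" by simp
    also have "\<dots> \<le> 2 ^ i * (2 ^ j * ((K * K) * K ^ (i + j)))"
      using K by (intro mult_mono Suc_le_two_power order_refl) auto
    also have "\<dots> = (K * K) * (2 * K) ^ (i + j)"
      by (simp add: power_add power_mult_distrib mult_ac)
    finally show ?thesis .
  qed
  then show ?thesis by (rule convergent2I)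
qed

lemma convergent2_add:
  assumes "convergent2 f" "convergent2 g"
  shows "convergent2 (f + g)"
proof -
  obtain K where f: "\<And>i j. norm (f $ i $ j) \<le> K * K ^ (i + j)"
    and g: "\<And>i j. norm (g $ i $ j) \<le> K * K ^ (i + j)"
    using convergent2_common[OF assms] by metis
  have "norm ((f + g) $ i $ j) \<le> (2 * K) * K ^ (i + j)" for i j
    using norm_triangle_le[OF add_mono[OF f[of i j] g[of i j]]] by (simp add: algebra_simps)
  then show ?thesis by (rule convergent2I)
qed

lemma convergent2_uminus: "convergent2 f \<Longrightarrow> convergent2 (- f)"
  unfolding convergent2_def by simp

lemma convergent2_const: "convergent2 (fps_const (fps_const c))"
  by (rule convergent2I[of _ "norm c" 1]) (auto simp: fps_const_def)

typedef germ = "{f. convergent2 f}" morphisms series Abs_germ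
  by (intro exI[of _ "fps_const (fps_const 0)"]) (simp only: mem_Collect_eq convergent2_const)

setup_lifting type_definition_germ

instantiation germ :: idom
begin

lift_definition zero_germ :: germ is 0
  using convergent2_const[of 0] by simp
lift_definition one_germ :: germ is 1
  using convergent2_const[of 1] by simp
lift_definition plus_germ :: "germ \<Rightarrow> germ \<Rightarrow> germ" is "(+)" by (rule convergent2_add)
lift_definition uminus_germ :: "germ \<Rightarrow> germ" is uminus by (rule convergent2_uminus)
lift_definition minus_germ :: "germ \<Rightarrow> germ \<Rightarrow> germ" is "(-)"
  unfolding diff_conv_add_uminus by (intro convergent2_add convergent2_uminus)
lift_definition times_germ :: "germ \<Rightarrow> germ \<Rightarrow> germ" is "(*)" by (rule convergent2_mult)

instance
  by standard (transfer; simp add: algebra_simps; fail)+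

end

lift_definition coef :: "germ \<Rightarrow> nat \<Rightarrow> nat \<Rightarrow> complex" is "\<lambda>f i j. f $ i $ j" .

lift_definition const :: "complex \<Rightarrow> germ" is "\<lambda>c. fps_const (fps_const c)"
  by (rule convergent2_const)

lift_definition X :: germ is fps_X
  by (rule convergent2I[of _ 1 1]) (auto simp: fps_X_def)

lift_definition Y :: germ is "fps_const fps_X"
  by (rule convergent2I[of _ 1 1]) (auto simp: fps_X_def)

lift_definition dx :: "germ \<Rightarrow> germ" is
  "\<lambda>f. Abs_fps (\<lambda>i. Abs_fps (\<lambda>j. of_nat (Suc i) * f $ Suc i $ j))"
proof -
  fix f assume "convergent2 f"
  then obtain K where K: "K \<ge> 1" and f: "\<And>i j. norm (f $ i $ j) \<le> K * K ^ (i + j)"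
    using convergent2_bound by metis
  have "norm (of_nat (Suc i) * f $ Suc i $ j) \<le> (K * K) * (2 * K) ^ (i + j)" for i j
  proof -
    have "norm (of_nat (Suc i) * f $ Suc i $ j) = real (Suc i) * norm (f $ Suc i $ j)"
      by (simp only: norm_mult norm_of_nat)
    also have "\<dots> \<le> 2 ^ (i + j) * (K * K ^ (Suc i + j))"
    proof (intro mult_mono f)
      show "real (Suc i) \<le> 2 ^ (i + j)"
        using Suc_le_two_power[of i] power_increasing[of i "i + j" "2::real"] by linarith
    qed (use K in auto)
    finally show ?thesis by (simp add: power_mult_distrib mult_ac)
  qed
  then show "convergent2 (Abs_fps (\<lambda>i. Abs_fps (\<lambda>j. of_nat (Suc i) * f $ Suc i $ j)))"
    by (intro convergent2I[of _ "K * K" "2 * K"]) simp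
qed

lift_definition dy :: "germ \<Rightarrow> germ" is
  "\<lambda>f. Abs_fps (\<lambda>i. Abs_fps (\<lambda>j. of_nat (Suc j) * f $ i $ Suc j))"
proof -
  fix f assume "convergent2 f"
  then obtain K where K: "K \<ge> 1" and f: "\<And>i j. norm (f $ i $ j) \<le> K * K ^ (i + j)"
    using convergent2_bound by metis
  have "norm (of_nat (Suc j) * f $ i $ Suc j) \<le> (K * K) * (2 * K) ^ (i + j)" for i j
  proof -
    have "norm (of_nat (Suc j) * f $ i $ Suc j) = real (Suc j) * norm (f $ i $ Suc j)"
      by (simp only: norm_mult norm_of_nat)
    also have "\<dots> \<le> 2 ^ (i + j) * (K * K ^ (i + Suc j))"
    proof (intro mult_mono f)
      show "real (Suc j) \<le> 2 ^ (i + j)"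
        using Suc_le_two_power[of j] power_increasing[of j "i + j" "2::real"] by linarith
    qed (use K in auto)
    finally show ?thesis by (simp add: power_mult_distrib mult_ac)
  qed
  then show "convergent2 (Abs_fps (\<lambda>i. Abs_fps (\<lambda>j. of_nat (Suc j) * f $ i $ Suc j)))"
    by (intro convergent2I[of _ "K * K" "2 * K"]) simp
qed

definition ideal_gen :: "germ set \<Rightarrow> germ set" where
  "ideal_gen S = module.span (*) S"

text \<open>The dimension of the complex vector space \<open>\<O>/I\<close>, possibly infinite: the supremum of the
  numbers of elements of \<open>\<O>\<close> whose classes modulo \<open>I\<close> are linearly independent.\<close>

definition codim :: "germ set \<Rightarrow> enat" where
  "codim I = Sup {enat (card B) | B. finite B \<and>
     (\<forall>c. (\<Sum>b\<in>B. const (c b) * b) \<in> I \<longrightarrow> (\<forall>b\<in>B. c b = 0))}"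


section \<open>Plane curve germs\<close>

text \<open>A curve germ at the origin is given by a local equation; it may be non-reduced.\<close>

definition curve_germ :: "germ \<Rightarrow> bool" where
  "curve_germ f \<longleftrightarrow> f \<noteq> 0 \<and> coef f 0 0 = 0"

text \<open>The local ring \<open>\<O>/\<langle>f\<rangle>\<close> has no nilpotent elements.\<close>

definition reduced :: "germ \<Rightarrow> bool" where
  "reduced f \<longleftrightarrow> (\<forall>g n. f dvd g ^ n \<longrightarrow> f dvd g)"

definition reduced_curve_singularity :: "germ \<Rightarrow> bool" where
  "reduced_curve_singularity f \<longleftrightarrow>
     curve_germ f \<and> reduced f \<and> coef (dx f) 0 0 = 0 \<and> coef (dy f) 0 0 = 0"

definition no_common_component :: "germ \<Rightarrow> germ \<Rightarrow> bool" where
  "no_common_component f h \<longleftrightarrow> \<not> (\<exists>p. irreducible p \<and> p dvd f \<and> p dvd h)"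

definition intersection_number :: "germ \<Rightarrow> germ \<Rightarrow> enat" where
  "intersection_number f h = codim (ideal_gen {f, h})"


section \<open>Equisingular first order deformations\<close>

text \<open>\<open>g \<in> \<mm>\<^sup>m\<close>, where \<open>\<mm>\<close> is the maximal ideal.\<close>

definition vanishes_to_order :: "nat \<Rightarrow> germ \<Rightarrow> bool" where
  "vanishes_to_order m g \<longleftrightarrow> (\<forall>i j. i + j < m \<longrightarrow> coef g i j = 0)"

definition mult :: "germ \<Rightarrow> nat" where
  "mult f = (LEAST m. \<exists>i j. i + j = m \<and> coef f i j \<noteq> 0)"

text \<open>
  The blowing up of the origin. Its exceptional divisor \<open>E\<close> is a projective line. Near the point
  of \<open>E\<close> that corresponds to the tangent direction \<open>y = c x\<close> there are coordinates in which the
  blowing up is \<open>(x, y) \<mapsto> (x, x (y + c))\<close> with \<open>E = {x = 0}\<close>; near the point that corresponds to the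
  direction \<open>x = 0\<close> there are coordinates in which it is \<open>(x, y) \<mapsto> (x y, y)\<close> with
  \<open>E = {y = 0}\<close>. The functions below are the pull-backs \<open>f(x, x (y + c))\<close> and \<open>f(x y, y)\<close>, collected by powers of \<open>x\<close>.
\<close>

lift_definition pull_x :: "complex \<Rightarrow> germ \<Rightarrow> germ" is
  "\<lambda>c f. Abs_fps (\<lambda>n. \<Sum>j\<le>n. fps_const (f $ (n - j) $ j) * (fps_X + fps_const c) ^ j)"
proof -
  fix c :: complex and f assume "convergent2 f"
  then obtain K where K: "K \<ge> 1" and f: "\<And>i j. norm (f $ i $ j) \<le> K * K ^ (i + j)"
    using convergent2_bound by metis
  define s where "s = 1 + norm c"
  have s: "s \<ge> 1" by (simp add: s_def)
  have pw: "norm (((fps_X + fps_const c) ^ j) $ k) \<le> s ^ j" for j k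
  proof (induction j arbitrary: k)
    case 0
    then show ?case by simp
  next
    case (Suc j)
    have "((fps_X + fps_const c) ^ Suc j) $ k
        = (if k = 0 then 0 else ((fps_X + fps_const c) ^ j) $ (k - 1))
          + c * ((fps_X + fps_const c) ^ j) $ k"
      by (simp add: distrib_right fps_X_mult_nth)
    also have "norm \<dots> \<le> s ^ j + norm c * s ^ j"
      using s by (intro norm_triangle_le add_mono) (auto simp: norm_mult intro: Suc mult_left_mono)
    finally show ?case by (simp add: s_def algebra_simps)
  qed
  have "norm ((\<Sum>j\<le>n. fps_const (f $ (n - j) $ j) * (fps_X + fps_const c) ^ j) $ k)
      \<le> K * (2 * K * s) ^ (n + k)" for n k
  proof -
    have "norm ((\<Sum>j\<le>n. fps_const (f $ (n - j) $ j) * (fps_X + fps_const c) ^ j) $ k)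
        = norm (\<Sum>j\<le>n. f $ (n - j) $ j * ((fps_X + fps_const c) ^ j) $ k)"
      by (simp add: fps_sum_nth)
    also have "\<dots> \<le> (\<Sum>j\<le>n. (K * K ^ n) * s ^ n)"
    proof (intro sum_norm_le)
      fix j assume "j \<in> {..n}"
      then have j: "j \<le> n" by simp
      have "norm (f $ (n - j) $ j * ((fps_X + fps_const c) ^ j) $ k) \<le> (K * K ^ ((n - j) + j)) * s ^ j"
        unfolding norm_mult using K by (intro mult_mono f pw) auto
      also have "\<dots> \<le> (K * K ^ n) * s ^ n"
        using j K s by (auto intro!: mult_left_mono power_increasing)
      finally show "norm (f $ (n - j) $ j * ((fps_X + fps_const c) ^ j) $ k) \<le> (K * K ^ n) * s ^ n" .
    qed
    also have "\<dots> = real (Suc n) * (K * (K * s) ^ n)" by (simp add: power_mult_distrib)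
    also have "\<dots> \<le> 2 ^ n * (K * (K * s) ^ n)"
      using K s by (intro mult_right_mono Suc_le_two_power) auto
    also have "\<dots> = K * (2 * K * s) ^ n" by (simp add: power_mult_distrib mult_ac)
    also have "\<dots> \<le> K * (2 * K * s) ^ (n + k)"
    proof -
      have "1 \<le> K * s" using K s by (metis mult_mono' mult_1 zero_le_one)
      then have "1 \<le> 2 * K * s" by simp
      then show ?thesis using K by (intro mult_left_mono power_increasing) auto
    qed
    finally show ?thesis .
  qed
  then show "convergent2 (Abs_fps (\<lambda>n. \<Sum>j\<le>n. fps_const (f $ (n - j) $ j) *
      (fps_X + fps_const c) ^ j))"
    by (intro convergent2I[of _ K "2 * K * s"]) simp
qed

lift_definition pull_y :: "germ \<Rightarrow> germ" is
  "\<lambda>f. Abs_fps (\<lambda>i. Abs_fps (\<lambda>n. if i \<le> n then f $ i $ (n - i) else 0))"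
proof -
  fix f assume "convergent2 f"
  then obtain K where K: "K \<ge> 1" and f: "\<And>i j. norm (f $ i $ j) \<le> K * K ^ (i + j)"
    using convergent2_bound by metis
  have "norm (if i \<le> n then f $ i $ (n - i) else 0) \<le> K * K ^ (i + n)" for i n
  proof (cases "i \<le> n")
    case True
    have "norm (f $ i $ (n - i)) \<le> K * K ^ (i + (n - i))" by (rule f)
    also have "\<dots> \<le> K * K ^ (i + n)"
      using K by (intro mult_left_mono power_increasing) auto
    finally show ?thesis using True by simp
  qed (use K in auto)
  then show "convergent2 (Abs_fps (\<lambda>i. Abs_fps (\<lambda>n. if i \<le> n then f $ i $ (n - i) else 0)))"
    by (intro convergent2I[of _ K K]) simp
qed

text \<open>
  Equisingularity in the sense of Wahl of the deformation \<open>f + \<epsilon> g\<close> over the spectrum of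
  \<open>\<complex>[\<epsilon>]/\<epsilon>\<^sup>2\<close> is the existence of a simultaneous embedded resolution: there are compatible sections
  through the infinitely near points of the curve that are blown up in its minimal embedded
  resolution, such that the successive strict transforms \<^emph>\<open>and\<close> the reduced exceptional divisors
  are equimultiple along these sections.

  At each infinitely near point, coordinates are chosen such that the exceptional divisor is
  the union of those of the lines \<open>{x = 0}\<close> and \<open>{y = 0}\<close> for which the Boolean \<open>E\<^sub>1\<close> respectively
  \<open>E\<^sub>2\<close> holds (not deformed), and \<open>f + \<epsilon> g\<close> is the equation of the strict transform of the
  deformation.

  A section over \<open>\<complex>[\<epsilon>]/\<epsilon>\<^sup>2\<close> through the origin is a point \<open>(\<epsilon> a, \<epsilon> b)\<close>. Moving it to the origin, that
  is, substituting \<open>(x + \<epsilon> a, y + \<epsilon> b)\<close>, turns \<open>f + \<epsilon> g\<close> into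
  \<open>f + \<epsilon> (g + a \<partial>f/\<partial>x + b \<partial>f/\<partial>y)\<close>. Equimultiplicity along the section of the exceptional divisor means
  that the section lies on each of its components through the point, that is, \<open>a = 0\<close> if \<open>E\<^sub>1\<close> and
  \<open>b = 0\<close> if \<open>E\<^sub>2\<close>; this includes the compatibility of the section with that of the preceding
  blowing up.
\<close>

text \<open>At the given point the curve \<open>f\<close> needs no further blowing up: either the curve does not
  pass through the point, or it is smooth and has normal crossings with the exceptional divisor.\<close>

definition resolved :: "bool \<Rightarrow> bool \<Rightarrow> germ \<Rightarrow> bool" where
  "resolved E\<^sub>1 E\<^sub>2 f \<longleftrightarrow>
     coef f 0 0 \<noteq> 0 \<or>
     (mult f = 1 \<and> \<not> (E\<^sub>1 \<and> E\<^sub>2) \<and>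
      (E\<^sub>1 \<longrightarrow> coef f 0 1 \<noteq> 0) \<and> (E\<^sub>2 \<longrightarrow> coef f 1 0 \<noteq> 0))"

text \<open>
  In the rule \<open>blow_up\<close>, \<open>f\<^sub>1 c + \<epsilon> g\<^sub>1 c\<close> and \<open>f\<^sub>2 + \<epsilon> g\<^sub>2\<close> are the strict transforms, at the points of
  the new exceptional divisor, of the family \<open>f + \<epsilon> g'\<close> blown up along the section.
\<close>

inductive equisingular_along :: "bool \<Rightarrow> bool \<Rightarrow> germ \<Rightarrow> germ \<Rightarrow> bool" where
  resolved: "resolved E\<^sub>1 E\<^sub>2 f \<Longrightarrow> equisingular_along E\<^sub>1 E\<^sub>2 f g"
| blow_up: "\<lbrakk> E\<^sub>1 \<longrightarrow> a = 0; E\<^sub>2 \<longrightarrow> b = 0;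
     g' = g + const a * dx f + const b * dy f;
     m = mult f; vanishes_to_order m g';
     \<And>c. pull_x c f = X ^ m * f\<^sub>1 c; \<And>c. pull_x c g' = X ^ m * g\<^sub>1 c;
     pull_y f = Y ^ m * f\<^sub>2; pull_y g' = Y ^ m * g\<^sub>2;
     \<And>c. equisingular_along True (E\<^sub>2 \<and> c = 0) (f\<^sub>1 c) (g\<^sub>1 c);
     equisingular_along E\<^sub>1 True f\<^sub>2 g\<^sub>2 \<rbrakk>
   \<Longrightarrow> equisingular_along E\<^sub>1 E\<^sub>2 f g"

definition equisingular :: "germ \<Rightarrow> germ \<Rightarrow> bool" where
  "equisingular f g \<longleftrightarrow> equisingular_along False False f g"


section \<open>Zero-dimensional schemes\<close>

text \<open>Zero-dimensional schemes supported at the origin are represented by their ideals.\<close>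

definition tjurina_ideal :: "germ \<Rightarrow> germ set" where
  "tjurina_ideal f = ideal_gen {f, dx f, dy f}"

definition es_ideal :: "germ \<Rightarrow> germ set" where
  "es_ideal f = {g. equisingular f g}"

definition tau :: "germ \<Rightarrow> enat" where
  "tau f = codim (tjurina_ideal f)"

definition tau_es :: "germ \<Rightarrow> enat" where
  "tau_es f = codim (es_ideal f)"

text \<open>The degree of \<open>D \<inter> X\<close>, where \<open>D\<close> has the local equation \<open>h\<close> and \<open>X\<close> the ideal \<open>I\<close>.\<close>

definition deg_inter :: "germ \<Rightarrow> germ set \<Rightarrow> enat" where
  "deg_inter h I = codim (ideal_gen (insert h I))"

definition Delta :: "germ \<Rightarrow> germ \<Rightarrow> germ set \<Rightarrow> enat" where
  "Delta f h I = min (intersection_number f h - deg_inter h I) (deg_inter h I)"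

text \<open>The supremum is a maximum, because only finitely many values occur.\<close>

definition gamma :: "germ \<Rightarrow> germ set \<Rightarrow> ereal" where
  "gamma f I = Sup {(ereal_of_enat (deg_inter h I))\<^sup>2 / ereal_of_enat (Delta f h I)
       + 2 * ereal_of_enat (deg_inter h I) + ereal_of_enat (Delta f h I)
     | h. curve_germ h \<and> no_common_component f h}"

definition gamma_es :: "germ \<Rightarrow> ereal" where
  "gamma_es f = gamma f (es_ideal f)"

definition gamma_ea :: "germ \<Rightarrow> ereal" where
  "gamma_ea f = gamma f (tjurina_ideal f)"

end

theory Submission
  imports Defs
begin

text \<open>
  Let \<open>n\<close> be the degree of \<open>D \<inter> X\<close>. The expression under the maximum is \<open>(n + \<Delta>)\<^sup>2 / \<Delta>\<close>, a
  convex function of \<open>\<Delta>\<close> whose values at \<open>\<Delta> = 1\<close> and \<open>\<Delta> = n\<close> are \<open>(n + 1)\<^sup>2\<close> and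
  \<open>4 n \<le> (n + 1)\<^sup>2\<close>. As \<open>n \<le> deg X\<close> and \<open>\<Delta> \<le> n\<close>, the bound follows from \<open>\<Delta> \<ge> 1\<close>, that is, from
  \<open>n \<ge> 1\<close> and \<open>n < (C, D)\<close>. The first inequality means that the ideal of \<open>X\<close> is contained in the
  maximal ideal. The second one, if \<open>(C, D)\<close> is finite, is a strict inclusion of \<open>\<langle>f, h\<rangle>\<close> in
  \<open>\<langle>h\<rangle> + I\<close>, where \<open>h\<close> is an equation of \<open>D\<close> and \<open>I\<close> the ideal of \<open>X\<close>. Since \<open>I\<close> contains the
  partial derivatives of \<open>f\<close>, it suffices that these are not both in \<open>\<langle>f, h\<rangle>\<close>.

  The reason is the chain rule. On a parametrized branch of \<open>D\<close>, the restriction of an element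
  of \<open>\<langle>f, h\<rangle>\<close> is a multiple of the restriction \<open>\<phi>\<close> of \<open>f\<close>; if this held for both derivatives of
  \<open>f\<close>, then \<open>\<phi>\<close> would divide \<open>\<phi>'\<close>, which is impossible: \<open>\<phi>\<close> vanishes at the origin, and it is
  nonzero as \<open>(C, D)\<close> is finite. The argument uses \<open>h\<close> only up to an order that is controlled by
  the intersection number, so an arc of sufficiently high contact with \<open>D\<close> replaces the branch
  (lemma \<open>derivatives_not_in_ideal\<close>). Finitely many steps of Newton's algorithm produce such an
  arc, in formal power series (lemma \<open>approximate_root\<close>).

  That the equisingularity ideal contains \<open>f\<close> and its derivatives is seen as follows. If some
  \<open>g\<close> is equisingular, the centres of the blowing ups that resolve \<open>f\<close> are known; with
  undeformed centres they resolve the families in the directions \<open>0\<close> and \<open>f\<close>, and the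
  derivatives differ from the direction \<open>0\<close> by a translation of the first section. If no \<open>g\<close> is
  equisingular, the codimension of the empty set is infinite and so is the right-hand side of
  the inequality.
\<close>

section \<open>Divisibility by powers of the variable\<close>

lemma X_power_dvd_iff:
  fixes F :: "'a::comm_ring_1 fps"
  shows "fps_X ^ k dvd F \<longleftrightarrow> (\<forall>i<k. F $ i = 0)"
proof
  assume "\<forall>i<k. F $ i = 0"
  then have "F = fps_X ^ k * fps_shift k F"
    by (intro fps_ext) (simp add: fps_X_power_mult_nth)
  then show "fps_X ^ k dvd F" ..
qed (auto simp: fps_X_power_mult_nth elim!: dvdE)

lemma X_power_dvd_power:
  fixes F :: "'a::comm_ring_1 fps"
  assumes "fps_X ^ m dvd F" "k \<le> m * i"
  shows "fps_X ^ k dvd F ^ i"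
proof -
  have "fps_X ^ (m * i) dvd F ^ i"
    using dvd_power_same[OF assms(1)] by (simp add: power_mult)
  with assms(2) show ?thesis
    by (meson dvd_trans le_imp_power_dvd)
qed

lemma compose_X_power_nth:
  fixes p :: "complex fps"
  assumes "d > 0"
  shows "(p oo fps_X ^ d) $ k = (if d dvd k then p $ (k div d) else 0)"
proof -
  have "(p oo fps_X ^ d) $ k = (\<Sum>i=0..k. p $ i * (if k = d * i then 1 else 0))"
    by (simp add: fps_compose_nth fps_X_power_nth flip: power_mult)
  also have "\<dots> = (\<Sum>i=0..k. if i = k div d then if d dvd k then p $ (k div d) else 0 else 0)"
    using assms by (intro sum.cong) auto
  finally show ?thesis by (simp add: sum.delta)
qed

section \<open>Substitution of an arc\<close>

text \<open>
  Substitution \<open>x = a(t)\<close>, \<open>y = b(t)\<close>. The series \<open>\<Sum>\<^sub>i (F\<^sub>i \<circ> b) a\<^sup>i\<close> converges \<open>t\<close>-adically if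
  \<open>a\<close> has no constant term: the terms with \<open>i > n\<close> do not contribute to the coefficient of
  \<open>t\<^sup>n\<close>, which is therefore a finite sum.
\<close>

definition arc_eval :: "complex fps \<Rightarrow> complex fps \<Rightarrow> complex fps fps \<Rightarrow> complex fps" where
  "arc_eval a b F = Abs_fps (\<lambda>n. (\<Sum>i\<le>n. (F $ i oo b) * a ^ i) $ n)"

text \<open>
  The factor \<open>c\<close> makes it possible to replace an evaluation by a finite sum inside a product.
\<close>

lemma mult_arc_eval_nth:
  assumes a: "a $ 0 = 0" and "k \<le> L"
  shows "(c * arc_eval a b F) $ k = (c * (\<Sum>i\<le>L. (F $ i oo b) * a ^ i)) $ k"
proof -
  have *: "arc_eval a b F $ l = (\<Sum>i\<le>L. (F $ i oo b) * a ^ i) $ l" if "l \<le> L" for l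
  proof -
    have "((F $ i oo b) * a ^ i) $ l = 0" if "l < i" for i
    proof -
      have "fps_X ^ 1 dvd a" unfolding X_power_dvd_iff using a by simp
      then have "fps_X ^ i dvd (F $ i oo b) * a ^ i"
        by (intro dvd_mult X_power_dvd_power[of 1]) auto
      with that show ?thesis unfolding X_power_dvd_iff by blast
    qed
    then show ?thesis
      unfolding arc_eval_def fps_nth_Abs_fps fps_sum_nth
      using that by (intro sum.mono_neutral_left) auto
  qed
  show ?thesis unfolding fps_mult_nth using \<open>k \<le> L\<close> by (intro sum.cong) (auto simp: *)
qed

lemmas arc_eval_nth = mult_arc_eval_nth[where c = 1, unfolded mult_1]

lemma arc_eval_nth_0: "arc_eval a b F $ 0 = F $ 0 $ 0"
  by (simp add: arc_eval_def)

lemma arc_eval_add: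
  "arc_eval a b (F + G) = arc_eval a b F + arc_eval a b G"
  by (rule fps_ext) (simp add: arc_eval_def fps_sum_nth fps_compose_add_distrib distrib_right sum.distrib)

lemma arc_eval_mult:
  assumes a: "a $ 0 = 0" and b: "b $ 0 = 0"
  shows "arc_eval a b (F * G) = arc_eval a b F * arc_eval a b G"
proof (rule fps_ext)
  fix k
  define u where "u i = (F $ i oo b) * a ^ i" for i
  define v where "v i = (G $ i oo b) * a ^ i" for i
  have "arc_eval a b (F * G) $ k = (\<Sum>p\<le>k. ((F * G) $ p oo b) * a ^ p) $ k"
    by (rule arc_eval_nth[OF a order_refl])
  also have "(\<Sum>p\<le>k. ((F * G) $ p oo b) * a ^ p) = (\<Sum>p\<le>k. \<Sum>i\<le>p. u i * v (p - i))"
  proof (rule sum.cong[OF refl])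
    fix p
    have "((F * G) $ p oo b) * a ^ p
        = (\<Sum>i\<le>p. ((F $ i oo b) * (G $ (p - i) oo b)) * a ^ p)"
      by (simp add: fps_mult_nth fps_compose_sum_distrib fps_compose_mult_distrib[OF b]
            sum_distrib_right atLeast0AtMost)
    also have "\<dots> = (\<Sum>i\<le>p. u i * v (p - i))"
    proof (intro sum.cong refl)
      fix i assume "i \<in> {..p}"
      then have "a ^ p = a ^ i * a ^ (p - i)" by (simp flip: power_add)
      then show "((F $ i oo b) * (G $ (p - i) oo b)) * a ^ p = u i * v (p - i)"
        by (simp add: u_def v_def mult_ac)
    qed
    finally show "((F * G) $ p oo b) * a ^ p = (\<Sum>i\<le>p. u i * v (p - i))" .
  qed
  also have "\<dots> = (\<Sum>(i,j)\<in>{(i,j). i + j \<le> k}. u i * v j)"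
    by (rule sum.triangle_reindex_eq[symmetric])
  also have "\<dots> $ k = (\<Sum>(i,j)\<in>{..k} \<times> {..k}. u i * v j) $ k"
    unfolding fps_sum_nth
  proof (intro sum.mono_neutral_left ballI)
    fix z assume z: "z \<in> {..k} \<times> {..k} - {(i,j). i + j \<le> k}"
    obtain i j where [simp]: "z = (i, j)" by (cases z)
    have "fps_X ^ 1 dvd a" unfolding X_power_dvd_iff using a by simp
    then have "fps_X ^ (i + j) dvd ((F $ i oo b) * (G $ j oo b)) * a ^ (i + j)"
      by (intro dvd_mult X_power_dvd_power[of 1]) auto
    also have "\<dots> = u i * v j" by (simp add: u_def v_def power_add mult_ac)
    finally show "(case z of (i, j) \<Rightarrow> u i * v j) $ k = 0"
      unfolding X_power_dvd_iff using z by auto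
  qed auto
  also have "(\<Sum>(i,j)\<in>{..k} \<times> {..k}. u i * v j) = (\<Sum>i\<le>k. u i) * (\<Sum>j\<le>k. v j)"
    by (simp add: sum_product sum.cartesian_product)
  also have "\<dots> $ k = ((\<Sum>i\<le>k. u i) * arc_eval a b G) $ k"
    unfolding v_def by (rule mult_arc_eval_nth[OF a order_refl, symmetric])
  also have "\<dots> = (arc_eval a b G * (\<Sum>i\<le>k. u i)) $ k" by (simp add: mult.commute)
  also have "\<dots> = (arc_eval a b G * arc_eval a b F) $ k"
    unfolding u_def by (rule mult_arc_eval_nth[OF a order_refl, symmetric])
  finally show "arc_eval a b (F * G) $ k = (arc_eval a b F * arc_eval a b G) $ k"
    by (simp add: mult.commute)
qed

lemma arc_eval_const: "a $ 0 = 0 \<Longrightarrow> arc_eval a b (fps_const (fps_const c)) = fps_const c"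
proof (rule fps_ext)
  fix k assume a: "a $ 0 = 0"
  have "arc_eval a b (fps_const (fps_const c)) $ k
      = (\<Sum>i\<le>k. if i = 0 then fps_const c else 0) $ k"
    unfolding arc_eval_nth[OF a order_refl]
    by (intro arg_cong[where f = "\<lambda>F. F $ k"] sum.cong) auto
  then show "arc_eval a b (fps_const (fps_const c)) $ k = fps_const c $ k"
    by simp
qed

lemma arc_eval_fps_X: "a $ 0 = 0 \<Longrightarrow> arc_eval a b fps_X = a"
proof (rule fps_ext)
  fix k assume a: "a $ 0 = 0"
  have "(fps_X $ i oo b) * a ^ i = (if i = 1 then a else 0)" for i by auto
  then have "arc_eval a b fps_X $ k = (\<Sum>i\<le>Suc k. if i = 1 then a else 0) $ k"
    by (subst arc_eval_nth[OF a, of k "Suc k"]) auto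
  then show "arc_eval a b fps_X $ k = a $ k" by simp
qed

lemma arc_eval_const_X:
  assumes a: "a $ 0 = 0" and b: "b $ 0 = 0"
  shows "arc_eval a b (fps_const fps_X) = b"
proof (rule fps_ext)
  fix k
  have "arc_eval a b (fps_const fps_X) $ k = (\<Sum>i\<le>k. if i = 0 then b else 0) $ k"
    unfolding arc_eval_nth[OF a order_refl]
    by (intro arg_cong[where f = "\<lambda>F. F $ k"] sum.cong) (auto simp: fps_X_fps_compose_startby0 b)
  then show "arc_eval a b (fps_const fps_X) $ k = b $ k" by simp
qed

lemma arc_eval_chain_rule:
  assumes a: "a $ 0 = 0" and b: "b $ 0 = 0"
  shows "fps_deriv (arc_eval a b F) = fps_deriv a * arc_eval a b (fps_deriv F)
    + fps_deriv b * arc_eval a b (Abs_fps (\<lambda>i. fps_deriv (F $ i)))"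
proof (rule fps_ext)
  fix k
  have "fps_deriv (arc_eval a b F) $ k = fps_deriv (\<Sum>i\<le>Suc k. (F $ i oo b) * a ^ i) $ k"
    by (simp only: fps_deriv_nth arc_eval_nth[OF a order_refl] Suc_eq_plus1)
  also have "fps_deriv (\<Sum>i\<le>Suc k. (F $ i oo b) * a ^ i)
      = (\<Sum>i\<le>Suc k. (F $ i oo b) * fps_deriv (a ^ i))
        + (\<Sum>i\<le>Suc k. fps_deriv b * ((fps_deriv (F $ i) oo b) * a ^ i))"
    by (simp only: fps_deriv_sum fps_deriv_mult fps_compose_deriv[OF b] sum.distrib) (simp add: mult_ac)
  also have "(\<Sum>i\<le>Suc k. (F $ i oo b) * fps_deriv (a ^ i))
      = (\<Sum>i\<le>k. fps_deriv a * ((fps_deriv F $ i oo b) * a ^ i))"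
  proof -
    have eq: "(F $ Suc i oo b) * fps_deriv (a ^ Suc i) = fps_deriv a * ((fps_deriv F $ i oo b) * a ^ i)" for i
    proof -
      have "(of_nat (Suc i) * F $ Suc i) oo b = of_nat (Suc i) * (F $ Suc i oo b)"
        by (simp add: fps_compose_mult_distrib[OF b] fps_of_nat[symmetric] fps_const_compose del: of_nat_Suc)
      then show ?thesis
        by (simp only: fps_deriv_power' diff_Suc_1 fps_deriv_nth) (simp add: fps_deriv_def mult_ac del: of_nat_Suc)
    qed
    show ?thesis
      by (subst sum.atMost_Suc_shift) (simp only: eq power_0 fps_deriv_1 mult_zero_right add_0_left)
  qed
  also have "((\<Sum>i\<le>k. fps_deriv a * ((fps_deriv F $ i oo b) * a ^ i))
        + (\<Sum>i\<le>Suc k. fps_deriv b * ((fps_deriv (F $ i) oo b) * a ^ i))) $ k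
      = (fps_deriv a * (\<Sum>i\<le>k. (fps_deriv F $ i oo b) * a ^ i)) $ k
        + (fps_deriv b * (\<Sum>i\<le>Suc k. (Abs_fps (\<lambda>i. fps_deriv (F $ i)) $ i oo b) * a ^ i)) $ k"
    by (simp only: sum_distrib_left fps_add_nth fps_nth_Abs_fps)
  also have "\<dots> = (fps_deriv a * arc_eval a b (fps_deriv F)
      + fps_deriv b * arc_eval a b (Abs_fps (\<lambda>i. fps_deriv (F $ i)))) $ k"
    unfolding fps_add_nth
    by (intro arg_cong2[where f = "(+)"] mult_arc_eval_nth[OF a, symmetric]) auto
  finally show "fps_deriv (arc_eval a b F) $ k = (fps_deriv a * arc_eval a b (fps_deriv F)
    + fps_deriv b * arc_eval a b (Abs_fps (\<lambda>i. fps_deriv (F $ i)))) $ k" .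
qed

section \<open>Approximate roots by Newton polygons\<close>

text \<open>
  The value of \<open>P(x, t\<^sup>d)\<close> at a series \<open>x = y(t)\<close>. The coefficients of \<open>P\<close> are series in the
  second coordinate of the plane and its indeterminate is the first one, in accordance with the
  nesting of the series of a germ. An integer \<open>d\<close> takes the place of the fractional exponents of
  Puiseux series.
\<close>

definition ramified_eval :: "nat \<Rightarrow> complex fps poly \<Rightarrow> complex fps \<Rightarrow> complex fps" where
  "ramified_eval d P y = poly (map_poly (\<lambda>c. c oo fps_X ^ d) P) y"

lemma poly_eq_sum_upto:
  fixes p :: "'a::comm_ring_1 poly"
  assumes "degree p \<le> D"
  shows "poly p x = (\<Sum>i\<le>D. coeff p i * x ^ i)"
  unfolding poly_altdef
  using assms by (intro sum.mono_neutral_left) (auto simp: coeff_eq_0)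

lemma ramified_eval_sum:
  assumes "degree P \<le> D"
  shows "ramified_eval d P y = (\<Sum>i\<le>D. (coeff P i oo fps_X ^ d) * y ^ i)"
proof -
  have "degree (map_poly (\<lambda>c. c oo fps_X ^ d) P) \<le> D"
    using assms by (intro degree_le) (auto simp: coeff_map_poly coeff_eq_0)
  from poly_eq_sum_upto[OF this] show ?thesis
    unfolding ramified_eval_def by (simp add: coeff_map_poly)
qed

lemma map_poly_pcompose_linear:
  fixes f :: "'a::comm_ring_1 \<Rightarrow> 'b::comm_ring_1"
  assumes f: "f 0 = 0" "\<And>x y. f (x + y) = f x + f y" "\<And>x y. f (x * y) = f x * f y"
  shows "map_poly f (pcompose p [:c, 1:]) = pcompose (map_poly f p) [:f c, 1:]"
proof (induction p)
  case (pCons a p)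
  have add: "map_poly f (p + q) = map_poly f p + map_poly f q" for p q
    by (rule poly_eqI) (simp add: coeff_map_poly f)
  have shift: "map_poly f (pCons 0 q) = pCons 0 (map_poly f q)" for q
    by (rule poly_eqI) (simp add: coeff_map_poly f coeff_pCons split: nat.splits)
  have const: "map_poly f [:a:] = [:f a:]"
    by (rule poly_eqI) (simp add: coeff_map_poly f coeff_pCons split: nat.splits)
  have smult: "map_poly f (smult c q) = smult (f c) (map_poly f q)" for q
    by (rule poly_eqI) (simp add: coeff_map_poly f)
  have "map_poly f (pCons a p) = pCons (f a) (map_poly f p)"
    by (rule poly_eqI) (simp add: coeff_map_poly f coeff_pCons split: nat.splits)
  then show ?case
    by (simp add: pcompose_pCons add shift const smult pCons.IH)
qed (simp add: f)

lemma ramified_eval_shift: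
  assumes "d > 0"
  shows "ramified_eval d (pcompose P [:fps_const c, 1:]) y = ramified_eval d P (y + fps_const c)"
proof -
  have "(fps_X ^ d :: complex fps) $ 0 = 0" using assms by simp
  then show ?thesis
    unfolding ramified_eval_def
    by (subst map_poly_pcompose_linear)
       (auto simp: fps_compose_add_distrib fps_compose_mult_distrib fps_const_compose poly_pcompose add.commute)
qed

lemma coeff_pcompose_linear_order:
  fixes q :: "complex poly"
  assumes "q \<noteq> 0"
  shows "coeff (pcompose q [:c, 1:]) (order c q) \<noteq> 0"
    and "j < order c q \<Longrightarrow> coeff (pcompose q [:c, 1:]) j = 0"
proof -
  obtain r where r: "q = [:-c, 1:] ^ order c q * r" "\<not> [:-c, 1:] dvd r"
    using order_decomp[OF assms] by metis
  have pw: "pcompose (p ^ n) s = pcompose p s ^ n" for p s :: "complex poly" and n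
    by (induction n) (simp_all add: pcompose_mult pcompose_1)
  have "pcompose q [:c, 1:] = pcompose [:-c, 1:] [:c, 1:] ^ order c q * pcompose r [:c, 1:]"
    by (subst r(1)) (simp add: pcompose_mult pw)
  also have "pcompose [:-c, 1:] [:c, 1:] = monom 1 1"
    by (simp add: pcompose_pCons monom_altdef)
  finally have eq: "pcompose q [:c, 1:] = monom 1 (order c q) * pcompose r [:c, 1:]"
    by (simp add: monom_power)
  have "coeff (pcompose r [:c, 1:]) 0 \<noteq> 0"
    using r(2) by (simp add: poly_pcompose poly_eq_0_iff_dvd flip: poly_0_coeff_0)
  then show "coeff (pcompose q [:c, 1:]) (order c q) \<noteq> 0"
    unfolding eq by (simp add: coeff_monom_mult)
  show "coeff (pcompose q [:c, 1:]) j = 0" if "j < order c q"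
    unfolding eq using that by (simp add: coeff_monom_mult)
qed

text \<open>
  The substitution \<open>x = t\<^sup>e (x' + c)\<close>, \<open>y = t\<^sup>d\<close>. The assumption \<open>slope\<close> says that no point of
  the Newton polygon lies below the line of slope \<open>e/d\<close> through its vertex \<open>(n, 0)\<close>, so that \<open>P\<close>
  becomes divisible by \<open>t\<^sup>e\<^sup>n\<close>. The quotient at \<open>t = 0\<close>, before the translation by \<open>c\<close>, is the
  polynomial \<open>q\<close> formed by the terms on this line; hence the translated quotient \<open>P'\<close> is regular
  in \<open>x'\<close> of order the multiplicity of \<open>c\<close> as a root of \<open>q\<close>.
\<close>

lemma newton_step:
  fixes P :: "complex fps poly"
  assumes d: "d > 0" and n: "n > 0" and reg: "coeff P n $ 0 \<noteq> 0"
    and slope: "\<And>i. i < n \<Longrightarrow> fps_X ^ (e * (n - i)) dvd coeff P i oo fps_X ^ d"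
    and e: "e > 0"
  obtains q where "degree q = n" "\<And>i. i \<le> n \<Longrightarrow> coeff q i = (coeff P i oo fps_X ^ d) $ (e * (n - i))"
    "\<And>c. \<exists>P'. coeff P' (order c q) $ 0 \<noteq> 0 \<and> (\<forall>j < order c q. coeff P' j $ 0 = 0) \<and>
       (\<forall>d' > 0. \<forall>y. ramified_eval (d * d') P (fps_X ^ (e * d') * (y + fps_const c))
          = fps_X ^ (e * d' * n) * ramified_eval d' P' y)"
proof -
  define p where "p i = coeff P i oo fps_X ^ d" for i
  define Q where "Q i = (if i < n then fps_shift (e * (n - i)) (p i) else p i * fps_X ^ (e * (i - n)))" for i
  define D where "D = max n (degree P)"
  have D: "n \<le> D" "degree P \<le> D" by (auto simp: D_def)
  have Q: "p i * fps_X ^ (e * i) = fps_X ^ (e * n) * Q i" for i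
  proof (cases "i < n")
    case True
    have "p i = fps_X ^ (e * (n - i)) * fps_shift (e * (n - i)) (p i)"
      using slope[OF True] unfolding p_def[symmetric] X_power_dvd_iff
      by (intro fps_ext) (simp add: fps_X_power_mult_nth)
    moreover have "e * n = e * (n - i) + e * i"
      using True by (simp flip: distrib_left)
    ultimately show ?thesis using True by (simp add: Q_def power_add mult_ac)
  next
    case False
    then have "e * i = e * n + e * (i - n)" by (simp flip: distrib_left)
    then show ?thesis using False by (simp add: Q_def power_add mult_ac)
  qed
  define R where "R = (\<Sum>i\<le>D. monom (Q i) i)"
  have Q_large: "Q i = 0" if "i > D" for i
    using that D by (auto simp: Q_def p_def coeff_eq_0)
  have coeff_R: "coeff R i = Q i" for i
    by (auto simp: R_def coeff_sum Q_large)
  have deg_R: "degree R \<le> D"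
    by (rule degree_le) (simp add: coeff_R Q_large)
  define q where "q = map_poly (\<lambda>c. c $ 0) R"
  have coeff_q: "coeff q i = (if i \<le> n then p i $ (e * (n - i)) else 0)" for i
    using e by (auto simp: q_def coeff_map_poly coeff_R Q_def fps_mult_nth)
  have "p n $ 0 \<noteq> 0" using reg by (simp add: p_def)
  then have deg_q: "degree q = n"
    by (intro antisym degree_le le_degree) (auto simp: coeff_q)
  then have q0: "q \<noteq> 0" using n by auto
  show ?thesis
  proof (rule that[of q])
    fix c
    define P' where "P' = pcompose R [:fps_const c, 1:]"
    have red: "coeff P' j $ 0 = coeff (pcompose q [:c, 1:]) j" for j
    proof -
      have "map_poly (\<lambda>c. c $ 0) P' = pcompose q [:c, 1:]"
        unfolding P'_def q_def by (subst map_poly_pcompose_linear) auto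
      from arg_cong[OF this, of "\<lambda>p. coeff p j"] show ?thesis by (simp add: coeff_map_poly)
    qed
    have eval: "ramified_eval (d * d') P (fps_X ^ (e * d') * (y + fps_const c))
          = fps_X ^ (e * d' * n) * ramified_eval d' P' y" if d': "d' > 0" for d' y
    proof -
      have X0: "(fps_X ^ d :: complex fps) $ 0 = 0" "(fps_X ^ d' :: complex fps) $ 0 = 0"
        using d d' by auto
      have Xc: "(fps_X ^ k oo fps_X ^ d' :: complex fps) = fps_X ^ (k * d')" for k
        by (simp only: fps_X_power_compose[OF X0(2)] power_mult[symmetric] mult.commute)
      have pc: "coeff P i oo fps_X ^ (d * d') = p i oo fps_X ^ d'" for i
        unfolding p_def Xc[symmetric] by (rule fps_compose_assoc) (use X0 in auto)
      have "ramified_eval (d * d') P (fps_X ^ (e * d') * (y + fps_const c))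
          = (\<Sum>i\<le>D. (p i oo fps_X ^ d') * (fps_X ^ (e * d') * (y + fps_const c)) ^ i)"
        by (simp add: ramified_eval_sum[OF D(2)] pc)
      also have "\<dots> = (\<Sum>i\<le>D. fps_X ^ (e * d' * n) * ((Q i oo fps_X ^ d') * (y + fps_const c) ^ i))"
      proof (rule sum.cong[OF refl])
        fix i
        have "(p i oo fps_X ^ d') * fps_X ^ (e * i * d') = fps_X ^ (e * n * d') * (Q i oo fps_X ^ d')"
          using arg_cong[OF Q[of i], of "\<lambda>F. F oo fps_X ^ d'"]
          by (simp only: fps_compose_mult_distrib[OF X0(2)] Xc)
        then show "(p i oo fps_X ^ d') * (fps_X ^ (e * d') * (y + fps_const c)) ^ i
            = fps_X ^ (e * d' * n) * ((Q i oo fps_X ^ d') * (y + fps_const c) ^ i)"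
          by (simp add: power_mult_distrib mult_ac flip: power_mult)
      qed
      also have "\<dots> = fps_X ^ (e * d' * n) * ramified_eval d' R (y + fps_const c)"
        by (simp add: ramified_eval_sum[OF deg_R] coeff_R sum_distrib_left)
      also have "ramified_eval d' R (y + fps_const c) = ramified_eval d' P' y"
        unfolding P'_def by (rule ramified_eval_shift[OF d', symmetric])
      finally show ?thesis .
    qed
    show "\<exists>P'. coeff P' (order c q) $ 0 \<noteq> 0 \<and> (\<forall>j < order c q. coeff P' j $ 0 = 0) \<and>
       (\<forall>d' > 0. \<forall>y. ramified_eval (d * d') P (fps_X ^ (e * d') * (y + fps_const c))
          = fps_X ^ (e * d' * n) * ramified_eval d' P' y)"
      using coeff_pcompose_linear_order[where c = c, OF q0] eval
      by (intro exI[of _ P']) (auto simp: red)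
  qed (auto simp: deg_q coeff_q p_def)
qed

lemma positive_degree_root:
  fixes q :: "complex poly"
  assumes "degree q > 0"
  obtains c where "0 < order c q" "order c q \<le> degree q"
proof -
  have "\<not> constant (poly q)" using assms by (simp add: constant_degree)
  then obtain c where "poly q c = 0" using fundamental_theorem_of_algebra by blast
  moreover have "q \<noteq> 0" using assms by auto
  ultimately show ?thesis using that order_gt_0_iff order_degree by blast
qed

text \<open>A power of a linear form \<open>x - c\<close> has a nonzero second coefficient unless \<open>c = 0\<close>.\<close>

lemma order_eq_degree_imp_monomial:
  fixes q :: "complex poly"
  assumes "order c q = degree q" "degree q > 0" "coeff q (degree q - 1) = 0" "j < degree q"
  shows "coeff q j = 0"
proof -
  define n where "n = degree q"
  have "q \<noteq> 0" using assms(2) by auto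
  then obtain r where r: "q = [:-c, 1:] ^ n * r"
    using order_1[of c q] assms(1) unfolding n_def by (metis dvdE)
  have "r \<noteq> 0" using \<open>q \<noteq> 0\<close> r by auto
  then have "degree q = n + degree r"
    by (subst r) (simp add: degree_mult_eq degree_linear_power)
  then obtain l where l: "r = [:l:]" unfolding n_def by (metis add_cancel_left_right degree_eq_zeroE)
  have q: "q = smult l ([:-c, 1:] ^ n)" using r l by simp
  have "l \<noteq> 0" using \<open>q \<noteq> 0\<close> q by auto
  have "coeff ([:-c, 1:] ^ n) (n - 1) = of_nat n * (- c)"
    using assms(2) unfolding n_def[symmetric]
    by (cases n) (simp_all only: coeff_linear_poly_power diff_Suc_1, auto)
  with assms(3) \<open>l \<noteq> 0\<close> assms(2) have "c = 0"
    unfolding n_def[symmetric] by (subst (asm) q) (auto simp: n_def)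
  then have "q = smult l (monom 1 n)" using q by (simp add: monom_altdef)
  from arg_cong[OF this, of "\<lambda>p. coeff p j"] show ?thesis using assms(4) by (simp add: n_def)
qed

text \<open>
  Approximations \<open>x = a(t)\<close>, \<open>y = t\<^sup>d\<close> of a branch of \<open>P = 0\<close> through the origin, with contact
  as large as desired relative to \<open>d\<close>. Each step of Newton's algorithm raises the contact or
  lowers the order of regularity \<open>n\<close>, and for a given contact \<open>K\<close> finitely many steps suffice:
  the induction is lexicographic in \<open>(n, K)\<close>. After a drop of \<open>n\<close> any contact may be asked for,
  which makes up for the ramification.
\<close>

lemma approximate_root:
  fixes P :: "complex fps poly"
  assumes "n > 0" "coeff P n $ 0 \<noteq> 0" "\<And>j. j < n \<Longrightarrow> coeff P j $ 0 = 0"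
  shows "\<exists>d y. d > 0 \<and> y $ 0 = 0 \<and> fps_X ^ (K * d) dvd ramified_eval d P y"
  using assms
proof (induction n arbitrary: K P rule: less_induct)
  case (less n)
  note outer = less.IH
  from less.prems show ?case
  proof (induction K arbitrary: P)
    case 0
    show ?case by (intro exI[of _ 1] exI[of _ 0]) auto
  next
    case (Suc K)
    show ?case
    proof (cases "\<forall>i<n. fps_X ^ (n - i) dvd coeff P i")
      case True
      (* No edge has slope below 1. The substitution x = t (x' + c), y = t is not ramified and
         raises the contact by n, so K may drop even if the order of regularity does not. *)
      have slope: "fps_X ^ (1 * (n - i)) dvd coeff P i oo fps_X ^ 1" if "i < n" for i
        using True that by simp
      obtain q where q: "degree q = n"
        "\<And>i. i \<le> n \<Longrightarrow> coeff q i = (coeff P i oo fps_X ^ 1) $ (1 * (n - i))"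
        "\<And>c. \<exists>P'. coeff P' (order c q) $ 0 \<noteq> 0 \<and> (\<forall>j < order c q. coeff P' j $ 0 = 0) \<and>
           (\<forall>d' > 0. \<forall>y. ramified_eval (1 * d') P (fps_X ^ (1 * d') * (y + fps_const c))
              = fps_X ^ (1 * d' * n) * ramified_eval d' P' y)"
        using newton_step[of 1 n P 1, OF zero_less_one Suc.prems(1,2) slope zero_less_one] by metis
      obtain c where c: "0 < order c q" "order c q \<le> n"
        using positive_degree_root[of q] q(1) Suc.prems(1) by metis
      obtain P' where P': "coeff P' (order c q) $ 0 \<noteq> 0" "\<And>j. j < order c q \<Longrightarrow> coeff P' j $ 0 = 0"
        "\<And>d' y. d' > 0 \<Longrightarrow> ramified_eval d' P (fps_X ^ d' * (y + fps_const c))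
              = fps_X ^ (d' * n) * ramified_eval d' P' y"
        using q(3)[of c] by auto
      have "\<exists>d y. d > 0 \<and> y $ 0 = 0 \<and> fps_X ^ (K * d) dvd ramified_eval d P' y"
      proof (cases "order c q = n")
        case True
        then show ?thesis using Suc.IH[of P'] P' Suc.prems(1) by auto
      next
        case False
        then show ?thesis using outer[of "order c q" P' K] P' c by auto
      qed
      then obtain d y where dy: "d > 0" "y $ 0 = 0" "fps_X ^ (K * d) dvd ramified_eval d P' y"
        by blast
      have "fps_X ^ (d * n + K * d) dvd ramified_eval d P (fps_X ^ d * (y + fps_const c))"
        unfolding P'(3)[OF dy(1)] power_add by (intro mult_dvd_mono dvd_refl dy(3))
      moreover have "Suc K * d \<le> d * n + K * d" using Suc.prems(1) by simp
      ultimately have "fps_X ^ (Suc K * d) dvd ramified_eval d P (fps_X ^ d * (y + fps_const c))"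
        by (meson dvd_trans le_imp_power_dvd)
      then show ?thesis using dy(1)
        by (intro exI[of _ d] exI[of _ "fps_X ^ d * (y + fps_const c)"]) auto
    next
      case False
      then obtain i0 where i0: "i0 < n" "\<not> fps_X ^ (n - i0) dvd coeff P i0" by blast
      define S where "S = {i. i < n \<and> coeff P i \<noteq> 0}"
      define s where "s i = real (subdegree (coeff P i)) / real (n - i)" for i
      (* The edge of the Newton polygon that starts at (n, 0) is the one of least slope; d and e
         are its width and height, not necessarily coprime. *)
      define j where "j = arg_min_on s S"
      have S: "finite S" "i0 \<in> S" using i0 by (auto simp: S_def)
      have j: "j \<in> S" and j_min: "\<And>i. i \<in> S \<Longrightarrow> s j \<le> s i"
        unfolding j_def using S arg_min_if_finite(1)[of S s] arg_min_least[of S _ s] by blast+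
      have jn: "j < n" "coeff P j \<noteq> 0" using j by (auto simp: S_def)
      define d where "d = n - j"
      define e where "e = subdegree (coeff P j)"
      have d: "d > 0" using jn by (simp add: d_def)
      have e: "e > 0" using Suc.prems(3)[OF jn(1)] jn(2) subdegree_eq_0_iff
        unfolding e_def by blast
      have e_min: "e * (n - i) \<le> d * subdegree (coeff P i)" if "i \<in> S" for i
      proof -
        have "s j \<le> s i" "i < n" using j_min that by (auto simp: S_def)
        then have "real e * real (n - i) \<le> real d * real (subdegree (coeff P i))"
          using d unfolding s_def d_def e_def by (simp add: field_simps)
        then show ?thesis by (metis of_nat_le_iff of_nat_mult)
      qed
      have "e < d"
      proof -
        have "subdegree (coeff P i0) < n - i0"
          using i0(2) by (metis X_power_dvd_iff nth_less_subdegree_zero not_less order_less_le_trans)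
        then have "d * subdegree (coeff P i0) < d * (n - i0)" using d by simp
        then have "e * (n - i0) < d * (n - i0)" using e_min[OF S(2)] by linarith
        then show ?thesis by simp
      qed
      have slope: "fps_X ^ (e * (n - i)) dvd coeff P i oo fps_X ^ d" if "i < n" for i
      proof (cases "coeff P i = 0")
        case False
        then have *: "e * (n - i) \<le> d * subdegree (coeff P i)"
          using that e_min by (simp add: S_def)
        show ?thesis
          unfolding X_power_dvd_iff compose_X_power_nth[OF d]
        proof (intro allI impI)
          fix k assume k: "k < e * (n - i)"
          have "coeff P i $ (k div d) = 0" if "d dvd k"
          proof (rule nth_less_subdegree_zero)
            have "k < d * subdegree (coeff P i)" using k * by linarith
            then show "k div d < subdegree (coeff P i)"
              using d by (simp add: less_mult_imp_div_less mult.commute)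
          qed
          then show "(if d dvd k then coeff P i $ (k div d) else 0) = 0" by simp
        qed
      qed simp
      obtain q where q: "degree q = n"
        "\<And>i. i \<le> n \<Longrightarrow> coeff q i = (coeff P i oo fps_X ^ d) $ (e * (n - i))"
        "\<And>c. \<exists>P'. coeff P' (order c q) $ 0 \<noteq> 0 \<and> (\<forall>j < order c q. coeff P' j $ 0 = 0) \<and>
           (\<forall>d' > 0. \<forall>y. ramified_eval (d * d') P (fps_X ^ (e * d') * (y + fps_const c))
              = fps_X ^ (e * d' * n) * ramified_eval d' P' y)"
        using newton_step[of d n P e, OF d Suc.prems(1,2) slope e] by metis
      obtain c where c: "0 < order c q" "order c q \<le> n"
        using positive_degree_root[of q] q(1) Suc.prems(1) by metis
      (* The coefficient of q at n - 1 vanishes, because the slope e/d is not an integer, while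
         the coefficient at j does not. So q is not a multiple of a power of a linear form,
         and the order of regularity drops. *)
      have "order c q \<noteq> n"
      proof
        assume "order c q = n"
        moreover have "coeff q (n - 1) = 0"
        proof -
          have "\<not> d dvd e" using e \<open>e < d\<close> by (auto dest: dvd_imp_le)
          moreover have "coeff q (n - 1) = (coeff P (n - 1) oo fps_X ^ d) $ e"
            using q(2)[of "n - 1"] Suc.prems(1) by simp
          ultimately show ?thesis by (simp add: compose_X_power_nth[OF d])
        qed
        ultimately have "coeff q j = 0"
          using order_eq_degree_imp_monomial[of c q j] q(1) Suc.prems(1) jn(1) by simp
        moreover have "coeff q j = coeff P j $ e"
          using q(2)[of j] jn(1) d by (simp add: compose_X_power_nth[OF d] flip: d_def)
        ultimately show False using jn(2) by (simp add: e_def)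
      qed
      then have "order c q < n" using c by simp
      obtain P' where P': "coeff P' (order c q) $ 0 \<noteq> 0" "\<And>j. j < order c q \<Longrightarrow> coeff P' j $ 0 = 0"
        "\<And>d' y. d' > 0 \<Longrightarrow> ramified_eval (d * d') P (fps_X ^ (e * d') * (y + fps_const c))
              = fps_X ^ (e * d' * n) * ramified_eval d' P' y"
        using q(3)[of c] by auto
      obtain d' y where dy: "d' > 0" "y $ 0 = 0"
          "fps_X ^ (Suc K * d * d') dvd ramified_eval d' P' y"
        using outer[OF \<open>order c q < n\<close> c(1) P'(1,2), of "Suc K * d"] by blast
      have "fps_X ^ (Suc K * (d * d')) dvd ramified_eval (d * d') P (fps_X ^ (e * d') * (y + fps_const c))"
        unfolding P'(3)[OF dy(1)] using dy(3) by (simp only: mult.assoc dvd_mult)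
      moreover have "(fps_X ^ (e * d') * (y + fps_const c)) $ 0 = 0"
        using e dy(1) by (simp add: fps_mult_nth)
      ultimately show ?thesis using d dy(1) by (intro exI[of _ "d * d'"] exI) auto
    qed
  qed
qed

section \<open>Arcs of high contact with a curve\<close>

text \<open>
  Some coordinate \<open>z\<close> of the arc is nonzero and \<open>F\<close> vanishes along the arc to an order above \<open>N\<close>
  times that of \<open>z\<close>. If the axis \<open>y = 0\<close> lies in \<open>F = 0\<close>, it is such an arc. Otherwise \<open>F\<close> is
  regular in \<open>x\<close>, and an approximate root of a truncation of \<open>F\<close> in \<open>x\<close> does it, because the
  omitted terms are multiples of \<open>x\<^sup>M\<close> with \<open>M > N\<close>.
\<close>

lemma arc_with_high_contact:
  fixes F :: "complex fps fps"
  assumes F0: "F $ 0 $ 0 = 0"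
  obtains a b z where "a $ 0 = 0" "b $ 0 = 0" "z \<in> {a, b}" "z \<noteq> 0"
    "fps_X ^ (N * subdegree z + 1) dvd arc_eval a b F"
proof (cases "\<forall>i. F $ i $ 0 = 0")
  case True
  then have "arc_eval fps_X 0 F = 0"
    by (intro fps_ext) (simp add: arc_eval_def)
  then show ?thesis by (intro that[of fps_X 0 fps_X]) auto
next
  case False
  define n where "n = (LEAST n. F $ n $ 0 \<noteq> 0)"
  have n: "F $ n $ 0 \<noteq> 0" "\<And>j. j < n \<Longrightarrow> F $ j $ 0 = 0"
    using False LeastI_ex[of "\<lambda>n. F $ n $ 0 \<noteq> 0"] not_less_Least[of _ "\<lambda>n. F $ n $ 0 \<noteq> 0"]
    unfolding n_def by blast+
  have "n > 0" using n(1) F0 by (intro gr0I) auto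
  define M where "M = n + N + 1"
  define P where "P = truncate_fps M F"
  have coeff_P: "coeff P i = (if i < M then F $ i else 0)" for i
    by (simp add: P_def coeff_truncate_fps)
  obtain d y where d: "d > 0" and y: "y $ 0 = 0"
    and P: "fps_X ^ (Suc N * d) dvd ramified_eval d P y"
    using approximate_root[of n P "Suc N"] n \<open>n > 0\<close> by (auto simp: coeff_P M_def)
  define b where "b = (fps_X ^ d :: complex fps)"
  have b: "b $ 0 = 0" "b \<noteq> 0" "subdegree b = d"
    using d by (simp_all add: b_def)
  (* The coordinate of least order, so that both coordinates are divisible by t^m. *)
  define z where "z = (if y \<noteq> 0 \<and> subdegree y < d then y else b)"
  define m where "m = subdegree z"
  have z: "z \<in> {y, b}" "z \<noteq> 0" using b by (auto simp: z_def)
  have m: "m > 0" using z y b(1) subdegree_eq_0_iff unfolding m_def by blast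
  have "m \<le> d" using b(3) by (auto simp: m_def z_def)
  have "fps_X ^ m dvd y"
  proof (cases "y = 0")
    case False
    then have "m \<le> subdegree y" using b(3) by (simp add: m_def z_def)
    then show ?thesis
      unfolding X_power_dvd_iff using nth_less_subdegree_zero[of _ y] by (meson order_less_le_trans)
  qed simp
  have "fps_X ^ (Suc N * m) dvd arc_eval y b F"
    unfolding X_power_dvd_iff
  proof (intro allI impI)
    fix k assume k: "k < Suc N * m"
    have low: "(ramified_eval d P y) $ k = 0"
      using P k \<open>m \<le> d\<close> unfolding X_power_dvd_iff
      by (meson mult_le_mono2 order_less_le_trans)
    have high: "((F $ i oo b) * y ^ i) $ k = 0" if "i \<ge> M" for i
    proof -
      have "Suc N * m \<le> m * i" using that unfolding M_def mult.commute[of m]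
        by (intro mult_le_mono1) simp
      then have "fps_X ^ (Suc N * m) dvd (F $ i oo b) * y ^ i"
        using \<open>fps_X ^ m dvd y\<close> by (intro dvd_mult X_power_dvd_power)
      with k show ?thesis unfolding X_power_dvd_iff by blast
    qed
    have "degree P \<le> k + M" by (rule degree_le) (simp add: coeff_P)
    have "arc_eval y b F $ k = (\<Sum>i\<le>k + M. ((F $ i oo b) * y ^ i) $ k)"
      by (subst arc_eval_nth[OF y, of k "k + M"]) (simp_all add: fps_sum_nth)
    also have "\<dots> = (\<Sum>i\<le>k + M. ((coeff P i oo b) * y ^ i) $ k)"
      by (intro sum.cong refl) (auto simp: coeff_P high)
    also have "\<dots> = (ramified_eval d P y) $ k"
      by (simp add: ramified_eval_sum[OF \<open>degree P \<le> k + M\<close>] b_def fps_sum_nth)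
    finally show "arc_eval y b F $ k = 0" using low by simp
  qed
  moreover have "N * m + 1 \<le> Suc N * m" using m by simp
  ultimately have "fps_X ^ (N * m + 1) dvd arc_eval y b F"
    by (meson dvd_trans le_imp_power_dvd)
  then show ?thesis using that[of y b z] y b z by (auto simp: m_def)
qed

section \<open>Ideals and their codimension\<close>

interpretation germ_module: module "(*) :: germ \<Rightarrow> germ \<Rightarrow> germ"
  by standard (simp_all add: algebra_simps)

lemma const_0: "const 0 = 0"
  and const_1: "const 1 = 1"
  and const_uminus: "const (- c) = - const c"
  and const_mult: "const (c * d) = const c * const d"
  by (transfer; simp)+

lemma ideal_gen_mono: "S \<subseteq> T \<Longrightarrow> ideal_gen S \<subseteq> ideal_gen T"
  unfolding ideal_gen_def by (rule germ_module.span_mono)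

lemma ideal_gen_pair: "w \<in> ideal_gen {f, h} \<Longrightarrow> \<exists>r s. w = r * f + s * h"
  unfolding ideal_gen_def by (auto simp: germ_module.span_insert diff_eq_eq add.commute)

definition independent_mod :: "germ set \<Rightarrow> germ set \<Rightarrow> bool" where
  "independent_mod J B \<longleftrightarrow> finite B \<and> (\<forall>c. (\<Sum>b\<in>B. const (c b) * b) \<in> J \<longrightarrow> (\<forall>b\<in>B. c b = 0))"

lemma codim_eq_Sup: "codim J = Sup {enat (card B) | B. independent_mod J B}"
  by (simp add: codim_def independent_mod_def)

lemma independent_mod_card_le: "independent_mod J B \<Longrightarrow> enat (card B) \<le> codim J"
  unfolding codim_eq_Sup by (rule Sup_upper) blast

lemma codim_antimono: "I \<subseteq> J \<Longrightarrow> codim J \<le> codim I"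
  unfolding codim_eq_Sup by (rule Sup_subset_mono) (auto simp: independent_mod_def)

lemma codim_attained:
  assumes "codim J = enat n"
  obtains B where "independent_mod J B" "card B = n"
proof -
  let ?S = "{enat (card B) | B. independent_mod J B}"
  have "?S \<subseteq> enat ` {..n}"
  proof
    fix k assume "k \<in> ?S"
    then obtain B where "k = enat (card B)" "independent_mod J B" by blast
    with independent_mod_card_le[of J B] assms show "k \<in> enat ` {..n}" by auto
  qed
  then have "finite ?S" by (rule finite_subset) simp
  moreover have "enat (card {}) \<in> ?S" using const_0 by (force simp: independent_mod_def)
  ultimately have "Max ?S \<in> ?S" by (intro Max_in) auto
  moreover have "Sup ?S = Max ?S" using \<open>enat (card {}) \<in> ?S\<close> \<open>finite ?S\<close> by (auto simp: Sup_enat_def)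
  ultimately have "Sup ?S \<in> ?S" by simp
  then show ?thesis using that assms unfolding codim_eq_Sup by force
qed

text \<open>
  An element of the larger ideal that is not in the smaller one extends every family that is
  independent modulo the larger ideal to one that is independent modulo the smaller one.
\<close>

lemma codim_strict_mono:
  assumes less: "ideal_gen S \<subset> ideal_gen T" and fin: "codim (ideal_gen T) \<noteq> \<infinity>"
  shows "codim (ideal_gen T) < codim (ideal_gen S)"
proof -
  obtain w where w: "w \<in> ideal_gen T" "w \<notin> ideal_gen S" using less by blast
  obtain n where n: "codim (ideal_gen T) = enat n" using fin by auto
  then obtain B where B: "independent_mod (ideal_gen T) B" "card B = n"
    using codim_attained by blast
  then have finB: "finite B" by (simp add: independent_mod_def)
  have "w \<notin> B"
  proof
    assume "w \<in> B"
    have "(\<Sum>b\<in>B. const (if b = w then 1 else 0) * b) = (\<Sum>b\<in>B. if b = w then w else 0)"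
      by (intro sum.cong) (auto simp: const_0 const_1)
    with \<open>w \<in> B\<close> finB w(1) have "(\<Sum>b\<in>B. const (if b = w then 1 else 0) * b) \<in> ideal_gen T"
      by simp
    with B(1) have "\<forall>b\<in>B. (if b = w then 1 else 0 :: complex) = 0"
      unfolding independent_mod_def by (elim conjE allE impE)
    with \<open>w \<in> B\<close> show False by auto
  qed
  have "independent_mod (ideal_gen S) (insert w B)"
    unfolding independent_mod_def
  proof (intro conjI allI impI)
    fix c assume "(\<Sum>b\<in>insert w B. const (c b) * b) \<in> ideal_gen S"
    then have c: "const (c w) * w + (\<Sum>b\<in>B. const (c b) * b) \<in> ideal_gen S"
      using finB \<open>w \<notin> B\<close> by simp
    then have "const (c w) * w + (\<Sum>b\<in>B. const (c b) * b) \<in> ideal_gen T" using less by blast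
    then have "(\<Sum>b\<in>B. const (c b) * b) \<in> ideal_gen T"
      using w(1) unfolding ideal_gen_def
      by (metis germ_module.span_add_eq germ_module.span_scale)
    then have cB: "\<forall>b\<in>B. c b = 0" using B(1) unfolding independent_mod_def by blast
    then have "const (c w) * w \<in> ideal_gen S" using c by (simp add: const_0)
    then have "const (inverse (c w)) * (const (c w) * w) \<in> ideal_gen S"
      unfolding ideal_gen_def by (rule germ_module.span_scale)
    then have "c w = 0" using w(2) by (cases "c w = 0") (auto simp: const_1 simp flip: mult.assoc const_mult)
    with cB show "\<forall>b\<in>insert w B. c b = 0" by simp
  qed (use finB in simp)
  from independent_mod_card_le[OF this] finB \<open>w \<notin> B\<close> B(2)
  have "enat (Suc n) \<le> codim (ideal_gen S)" by simp
  then show ?thesis unfolding n by (rule order_less_le_trans[rotated]) simp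
qed

text \<open>
  The \<open>N + 1\<close> powers \<open>1, z, \<dots>, z\<^sup>N\<close> are too many to be independent modulo an ideal of
  codimension \<open>N\<close>. If two of them coincide, their difference is a relation.
\<close>

lemma powers_dependent:
  assumes "codim J = enat N" and "0 \<in> J"
  obtains c where "(\<Sum>k\<le>N. const (c k) * z ^ k) \<in> J" "\<exists>k\<le>N. c k \<noteq> 0"
proof (cases "inj_on (\<lambda>k. z ^ k) {..N}")
  case True
  let ?B = "(\<lambda>k. z ^ k) ` {..N}"
  have "card ?B = Suc N" using True by (simp add: card_image)
  then have "\<not> independent_mod J ?B"
    using independent_mod_card_le[of J ?B] assms by auto
  then obtain c where c: "(\<Sum>b\<in>?B. const (c b) * b) \<in> J" "\<exists>b\<in>?B. c b \<noteq> 0"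
    unfolding independent_mod_def by auto
  then show ?thesis
    using True by (intro that[of "\<lambda>k. c (z ^ k)"]) (auto simp: sum.reindex)
next
  case False
  then obtain i j where ij: "i \<le> N" "j \<le> N" "i \<noteq> j" "z ^ i = z ^ j"
    by (auto simp: inj_on_def)
  define c :: "nat \<Rightarrow> complex" where "c k = (if k = i then 1 else if k = j then -1 else 0)" for k
  have "(\<Sum>k\<le>N. const (c k) * z ^ k) = (\<Sum>k\<le>N. (if k = i then z ^ i else 0) - (if k = j then z ^ j else 0))"
    using ij(3) by (intro sum.cong) (auto simp: c_def const_0 const_1 const_uminus)
  also have "\<dots> = 0" using ij by (simp add: sum_subtractf)
  finally show ?thesis using assms(2) ij by (intro that[of c]) (auto simp: c_def)
qed

section \<open>Intersection numbers exceed the degree of the intersection with the Tjurina scheme\<close>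

definition along :: "complex fps \<Rightarrow> complex fps \<Rightarrow> germ \<Rightarrow> complex fps" where
  "along a b g = arc_eval a b (series g)"

lemma series_dx: "series (dx f) = fps_deriv (series f)"
  by (rule fps_ext, rule fps_ext) (simp add: dx.rep_eq fps_mult_of_nat_nth del: of_nat_Suc)

lemma series_dy: "series (dy f) = Abs_fps (\<lambda>i. fps_deriv (series f $ i))"
  by (rule fps_ext, rule fps_ext) (simp add: dy.rep_eq del: of_nat_Suc)

context
  fixes a b :: "complex fps"
  assumes a: "a $ 0 = 0" and b: "b $ 0 = 0"
begin

lemma along_add: "along a b (f + g) = along a b f + along a b g"
  by (simp add: along_def plus_germ.rep_eq arc_eval_add)

lemma along_mult: "along a b (f * g) = along a b f * along a b g"
  by (simp add: along_def times_germ.rep_eq arc_eval_mult[OF a b])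

lemma along_const: "along a b (const c) = fps_const c"
  by (simp add: along_def const.rep_eq arc_eval_const[OF a])

lemma along_X: "along a b X = a"
  by (simp add: along_def X.rep_eq arc_eval_fps_X[OF a])

lemma along_Y: "along a b Y = b"
  by (simp add: along_def Y.rep_eq arc_eval_const_X[OF a b])

lemma along_power: "along a b (f ^ n) = along a b f ^ n"
  by (induction n) (simp_all add: along_mult along_const[of 1, unfolded const_1 fps_const_1_eq_1])

lemma along_polynomial:
  "along a b (\<Sum>k\<le>N. const (c k) * z ^ k) = (\<Sum>k\<le>N. fps_const (c k) * along a b z ^ k)"
  by (induction N) (simp_all add: along_add along_mult along_const along_power)

lemma along_chain_rule:
  "fps_deriv (along a b f) = fps_deriv a * along a b (dx f) + fps_deriv b * along a b (dy f)"
  unfolding along_def series_dx series_dy by (rule arc_eval_chain_rule[OF a b])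

end

lemma along_nth_0: "along a b f $ 0 = coef f 0 0"
  by (simp add: along_def arc_eval_nth_0 coef.rep_eq)

text \<open>The least exponent that occurs in the polynomial determines the order of the sum.\<close>

lemma polynomial_contact_le:
  fixes z :: "complex fps"
  assumes z: "z \<noteq> 0" "z $ 0 = 0" and c: "\<exists>k\<le>N. c k \<noteq> 0"
  shows "\<not> fps_X ^ (N * subdegree z + 1) dvd (\<Sum>k\<le>N. fps_const (c k) * z ^ k)"
proof -
  define m where "m = subdegree z"
  have m: "m > 0" using z subdegree_eq_0_iff unfolding m_def by blast
  define l where "l = (LEAST k. c k \<noteq> 0)"
  have l: "c l \<noteq> 0" "l \<le> N" "\<And>k. k < l \<Longrightarrow> c k = 0"
    using c LeastI_ex[of "\<lambda>k. c k \<noteq> 0"] Least_le[of "\<lambda>k. c k \<noteq> 0"] not_less_Least[of _ "\<lambda>k. c k \<noteq> 0"]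
    unfolding l_def by (blast intro: order_trans)+
  have "(\<Sum>k\<le>N. fps_const (c k) * z ^ k) $ (l * m) = (\<Sum>k\<le>N. c k * (z ^ k) $ (l * m))"
    by (simp add: fps_sum_nth)
  also have "\<dots> = (\<Sum>k\<le>N. if k = l then c l * (z $ m) ^ l else 0)"
  proof (intro sum.cong refl)
    fix k
    consider "k < l" | "k = l" | "l < k" by linarith
    then show "c k * (z ^ k) $ (l * m) = (if k = l then c l * (z $ m) ^ l else 0)"
    proof cases
      case 3
      then show ?thesis using m by (simp add: fps_pow_nth_below_subdegree m_def)
    qed (auto simp: l(3) m_def)
  qed
  also have "\<dots> = c l * (z $ m) ^ l" using l(2) by simp
  finally have "(\<Sum>k\<le>N. fps_const (c k) * z ^ k) $ (l * m) \<noteq> 0"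
    using l(1) z(1) by (simp add: m_def)
  moreover have "l * m < N * m + 1" using l(2) by (simp add: le_imp_less_Suc)
  ultimately show ?thesis unfolding X_power_dvd_iff m_def by blast
qed

text \<open>
  Choose an arc along which \<open>h\<close> vanishes to an order above \<open>N\<close> times that of a coordinate, where
  \<open>N\<close> is the intersection number. A nontrivial polynomial of degree at most \<open>N\<close> in this
  coordinate lies in \<open>\<langle>f, h\<rangle>\<close>. Its order along the arc is smaller than that of \<open>h\<close>, so the
  restriction \<open>\<phi>\<close> of \<open>f\<close> also has an order \<open>l\<close> smaller than that of \<open>h\<close>. If both derivatives
  were in \<open>\<langle>f, h\<rangle>\<close>, their restrictions, and by the chain rule also \<open>\<phi>'\<close>, would be divisible by
  \<open>t\<^sup>l\<close>; but \<open>\<phi>'\<close> has order \<open>l - 1\<close>, because \<open>l > 0\<close>.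
\<close>

lemma derivatives_not_in_ideal:
  assumes f: "coef f 0 0 = 0" and h: "coef h 0 0 = 0"
    and fin: "codim (ideal_gen {f, h}) \<noteq> \<infinity>"
  shows "\<not> {dx f, dy f} \<subseteq> ideal_gen {f, h}"
proof
  assume sub: "{dx f, dy f} \<subseteq> ideal_gen {f, h}"
  obtain N where N: "codim (ideal_gen {f, h}) = enat N" using fin by auto
  have "series h $ 0 $ 0 = 0" using h by (simp add: coef.rep_eq)
  then obtain a b z where a: "a $ 0 = 0" and b: "b $ 0 = 0" and z: "z \<in> {a, b}" "z \<noteq> 0"
    and contact: "fps_X ^ (N * subdegree z + 1) dvd along a b h"
    unfolding along_def by (rule arc_with_high_contact)
  note along = along_add[OF a b] along_mult[OF a b]
  define \<phi> where "\<phi> = along a b f"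
  define L where "L = N * subdegree z + 1"
  have ideal: "\<exists>u v. along a b g = u * \<phi> + v * along a b h" if "g \<in> ideal_gen {f, h}" for g
    using ideal_gen_pair[OF that] unfolding \<phi>_def by (metis along)
  have "\<not> fps_X ^ L dvd \<phi>"
  proof
    assume \<phi>: "fps_X ^ L dvd \<phi>"
    obtain g where g: "along a b g = z"
      using z(1) along_X[OF a b] along_Y[OF a b] by auto
    have "0 \<in> ideal_gen {f, h}" unfolding ideal_gen_def by (rule germ_module.span_zero)
    then obtain c where c: "(\<Sum>k\<le>N. const (c k) * g ^ k) \<in> ideal_gen {f, h}" "\<exists>k\<le>N. c k \<noteq> 0"
      using powers_dependent[OF N, of g] by blast
    have "\<not> fps_X ^ L dvd along a b (\<Sum>k\<le>N. const (c k) * g ^ k)"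
      unfolding along_polynomial[OF a b] g L_def using z a b by (intro polynomial_contact_le c(2)) auto
    then show False using ideal[OF c(1)] \<phi> contact unfolding L_def by force
  qed
  then obtain k where k: "k < L" "\<phi> $ k \<noteq> 0" unfolding X_power_dvd_iff by blast
  then have "\<phi> \<noteq> 0" by (intro notI) simp
  have small: "subdegree \<phi> < L" using subdegree_leI[OF k(2)] k(1) by simp
  define l where "l = subdegree \<phi>"
  have "\<phi> $ 0 = 0" using f by (simp add: \<phi>_def along_nth_0)
  then have l: "l > 0" using \<open>\<phi> \<noteq> 0\<close> subdegree_eq_0_iff unfolding l_def by blast
  have dvd: "fps_X ^ l dvd \<phi>"
    unfolding X_power_dvd_iff l_def using nth_less_subdegree_zero by blast
  have "fps_X ^ l dvd along a b h"
    using dvd_trans[OF le_imp_power_dvd contact, of l] small by (simp add: l_def L_def)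
  then have "fps_X ^ l dvd along a b g" if "g \<in> ideal_gen {f, h}" for g
    using ideal[OF that] dvd by (metis dvd_add dvd_mult)
  then have "fps_X ^ l dvd fps_deriv \<phi>"
    unfolding \<phi>_def along_chain_rule[OF a b] using sub by (intro dvd_add dvd_mult) auto
  then have "fps_deriv \<phi> $ (l - 1) = 0"
    unfolding X_power_dvd_iff using l by (metis diff_less zero_less_one)
  moreover have "fps_deriv \<phi> $ (l - 1) = of_nat l * \<phi> $ l" using l by simp
  ultimately show False using \<open>\<phi> \<noteq> 0\<close> l by (simp add: l_def)
qed

section \<open>The bound for a scheme inside the Tjurina scheme\<close>

lemma coef_mult_0: "coef (g * k) 0 0 = coef g 0 0 * coef k 0 0"
  by transfer (simp add: fps_mult_nth)

lemma coef_add: "coef (g + k) i j = coef g i j + coef k i j"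
  by transfer simp

lemma coef_const: "coef (const c) 0 0 = c"
  by transfer simp

lemma ideal_gen_vanishing:
  assumes "\<And>g. g \<in> S \<Longrightarrow> coef g 0 0 = 0" "g \<in> ideal_gen S"
  shows "coef g 0 0 = 0"
proof -
  have "coef 0 0 0 = 0" by transfer simp
  then have "germ_module.subspace {g. coef g 0 0 = 0}"
    unfolding germ_module.subspace_def by (simp add: coef_mult_0 coef_add)
  then have "ideal_gen S \<subseteq> {g. coef g 0 0 = 0}"
    unfolding ideal_gen_def using assms(1) by (intro germ_module.span_minimal) auto
  with assms(2) show ?thesis by blast
qed

lemma codim_proper:
  assumes "\<And>g. g \<in> J \<Longrightarrow> coef g 0 0 = 0"
  shows "1 \<le> codim J"
proof -
  have "independent_mod J {1}"
    unfolding independent_mod_def using assms[of "const _"] by (auto simp: coef_const)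
  from independent_mod_card_le[OF this] show ?thesis by (simp add: one_enat_def)
qed

text \<open>The difference of the two sides is \<open>(\<delta> - 1) (n\<^sup>2 - \<delta>) / \<delta>\<close>.\<close>

lemma gamma_term_le:
  fixes n \<delta> :: real
  assumes "1 \<le> \<delta>" "\<delta> \<le> n"
  shows "n\<^sup>2 / \<delta> + 2 * n + \<delta> \<le> (n + 1)\<^sup>2"
proof -
  have "n * 1 \<le> n * n" using assms by (intro mult_left_mono) auto
  with assms have "\<delta> \<le> n\<^sup>2" unfolding power2_eq_square by linarith
  then have "0 \<le> (\<delta> - 1) * (n\<^sup>2 - \<delta>)"
    using assms by (intro mult_nonneg_nonneg) auto
  then have "n\<^sup>2 + \<delta>\<^sup>2 \<le> (n\<^sup>2 + 1) * \<delta>" by (simp add: algebra_simps power2_eq_square)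
  then have "n\<^sup>2 / \<delta> + \<delta> \<le> n\<^sup>2 + 1" using assms by (simp add: field_simps power2_eq_square)
  then show ?thesis by (simp add: power2_sum)
qed

text \<open>
  With \<open>n = deg (D \<inter> X) \<ge> 1\<close>, the point is that \<open>n < (C, D)\<close>, since then \<open>1 \<le> \<Delta> \<le> n\<close>. If
  \<open>(C, D)\<close> is finite, this holds because \<open>\<langle>h\<rangle> + I\<close> contains the derivatives of \<open>f\<close>, and \<open>\<langle>f, h\<rangle>\<close>
  does not contain both.
\<close>

lemma gamma_le:
  assumes f: "coef f 0 0 = 0" and tj: "{f, dx f, dy f} \<subseteq> I"
    and I: "\<And>g. g \<in> I \<Longrightarrow> coef g 0 0 = 0"
  shows "gamma f I \<le> (ereal_of_enat (codim I) + 1)\<^sup>2"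
proof (cases "codim I")
  case infinity
  then show ?thesis by (simp add: power2_eq_square)
next
  case (enat t)
  show ?thesis
    unfolding gamma_def
  proof (rule Sup_least, clarify)
    fix h assume "curve_germ h"
    then have h: "coef h 0 0 = 0" by (simp add: curve_germ_def)
    define J where "J = ideal_gen (insert h I)"
    have "I \<subseteq> J" unfolding J_def ideal_gen_def using germ_module.span_superset by blast
    then have "codim J \<le> enat t" using codim_antimono enat by metis
    then obtain n where n: "codim J = enat n" and "n \<le> t" by (cases "codim J") auto
    have "1 \<le> codim J"
      unfolding J_def using h I by (intro codim_proper) (metis ideal_gen_vanishing insertE)
    then have "1 \<le> n" using n by (simp add: one_enat_def)
    have contact: "enat n < intersection_number f h"
    proof (cases "codim (ideal_gen {f, h}) = \<infinity>")
      case True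
      then show ?thesis by (simp add: intersection_number_def)
    next
      case False
      then have "\<not> {dx f, dy f} \<subseteq> ideal_gen {f, h}" by (rule derivatives_not_in_ideal[OF f h])
      moreover have "{dx f, dy f} \<subseteq> J" using tj \<open>I \<subseteq> J\<close> by blast
      moreover have "ideal_gen {f, h} \<subseteq> J" unfolding J_def using tj by (intro ideal_gen_mono) auto
      ultimately have "ideal_gen {f, h} \<subset> J" by blast
      then have "codim J < codim (ideal_gen {f, h})"
        unfolding J_def using n by (intro codim_strict_mono) (auto simp: J_def)
      then show ?thesis by (simp add: n intersection_number_def)
    qed
    obtain \<delta> where \<delta>: "Delta f h I = enat \<delta>" "1 \<le> \<delta>" "\<delta> \<le> n"
    proof (cases "intersection_number f h")
      case (enat i)
      then show ?thesis using contact \<open>1 \<le> n\<close> n that[of "min (i - n) n"]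
        by (simp add: Delta_def deg_inter_def flip: J_def)
    next
      case infinity
      then show ?thesis using \<open>1 \<le> n\<close> n that[of n]
        by (simp add: Delta_def deg_inter_def flip: J_def)
    qed
    have "(ereal_of_enat (deg_inter h I))\<^sup>2 / ereal_of_enat (Delta f h I)
        + 2 * ereal_of_enat (deg_inter h I) + ereal_of_enat (Delta f h I)
        = ereal ((real n)\<^sup>2 / real \<delta> + 2 * real n + real \<delta>)"
      using \<delta> n by (simp add: deg_inter_def flip: J_def)
    also have "\<dots> \<le> ereal ((real n + 1)\<^sup>2)"
      using \<delta> by (simp add: gamma_term_le)
    also have "\<dots> \<le> ereal ((real t + 1)\<^sup>2)"
      using \<open>n \<le> t\<close> by (simp add: power_mono)
    also have "\<dots> = (ereal_of_enat (codim I) + 1)\<^sup>2"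
      by (simp add: enat one_ereal_def)
    finally show "(ereal_of_enat (deg_inter h I))\<^sup>2 / ereal_of_enat (Delta f h I)
        + 2 * ereal_of_enat (deg_inter h I) + ereal_of_enat (Delta f h I)
        \<le> (ereal_of_enat (codim I) + 1)\<^sup>2" .
  qed
qed

section \<open>The equisingularity ideal\<close>

lemma zero_vanishes: "vanishes_to_order m 0"
  unfolding vanishes_to_order_def by transfer simp

lemma pull_zero: "pull_x c 0 = 0" "pull_y 0 = 0"
  by (transfer; simp add: fps_eq_iff)+

lemma equation_vanishes: "vanishes_to_order (mult f) f"
  unfolding vanishes_to_order_def mult_def using not_less_Least by blast

text \<open>
  A sequence of blowing ups that resolves one deformation of \<open>f\<close> resolves the trivial one, with
  undeformed centres.
\<close>

lemma equisingular_along_zero: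
  "equisingular_along E\<^sub>1 E\<^sub>2 f g \<Longrightarrow> equisingular_along E\<^sub>1 E\<^sub>2 f 0"
proof (induction rule: equisingular_along.induct)
  case (resolved E\<^sub>1 E\<^sub>2 f g)
  then show ?case by (rule equisingular_along.resolved)
next
  case (blow_up E\<^sub>1 a E\<^sub>2 b g' g f m f\<^sub>1 g\<^sub>1 f\<^sub>2 g\<^sub>2)
  show ?case
    by (rule equisingular_along.blow_up[where a = 0 and b = 0 and g' = 0 and m = m
          and f\<^sub>1 = f\<^sub>1 and g\<^sub>1 = "\<lambda>c. 0" and f\<^sub>2 = f\<^sub>2 and g\<^sub>2 = 0])
       (use blow_up in \<open>simp_all add: const_0 zero_vanishes pull_zero\<close>)
qed

text \<open>
  In the direction \<open>f\<close> the family \<open>(1 + \<epsilon>) f\<close> has constant zero set, so the undeformed centres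
  serve again.
\<close>

lemma equisingular_along_self:
  "equisingular_along E\<^sub>1 E\<^sub>2 f g \<Longrightarrow> equisingular_along E\<^sub>1 E\<^sub>2 f f"
proof (induction rule: equisingular_along.induct)
  case (resolved E\<^sub>1 E\<^sub>2 f g)
  then show ?case by (rule equisingular_along.resolved)
next
  case (blow_up E\<^sub>1 a E\<^sub>2 b g' g f m f\<^sub>1 g\<^sub>1 f\<^sub>2 g\<^sub>2)
  show ?case
    by (rule equisingular_along.blow_up[where a = 0 and b = 0 and g' = f and m = m
          and f\<^sub>1 = f\<^sub>1 and g\<^sub>1 = f\<^sub>1 and f\<^sub>2 = f\<^sub>2 and g\<^sub>2 = f\<^sub>2])
       (use blow_up in \<open>simp_all add: const_0 equation_vanishes\<close>)
qed

text \<open>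
  Moving the section back undoes an infinitesimal translation: \<open>f\<close> becomes the trivial
  deformation.
\<close>

lemma equisingular_translation:
  assumes "equisingular_along False False f g" and "k = - (const a * dx f + const b * dy f)"
  shows "equisingular_along False False f k"
  using equisingular_along_zero[OF assms(1)]
proof cases
  case resolved
  then show ?thesis by (rule equisingular_along.resolved)
next
  case (blow_up a' b' g' m f\<^sub>1 g\<^sub>1 f\<^sub>2 g\<^sub>2)
  show ?thesis
    by (rule equisingular_along.blow_up[where a = a and b = b and g' = 0 and m = m
          and f\<^sub>1 = f\<^sub>1 and g\<^sub>1 = "\<lambda>c. 0" and f\<^sub>2 = f\<^sub>2 and g\<^sub>2 = 0])
       (use blow_up in \<open>auto simp: assms(2) zero_vanishes pull_zero intro: equisingular_along_zero\<close>)
qed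

lemma tjurina_generators_equisingular:
  assumes "equisingular f g"
  shows "{f, dx f, dy f} \<subseteq> es_ideal f"
proof -
  note g = assms[unfolded equisingular_def]
  have "equisingular_along False False f (dx f)"
    by (rule equisingular_translation[OF g, of _ "-1" 0]) (simp add: const_0 const_1 const_uminus)
  moreover have "equisingular_along False False f (dy f)"
    by (rule equisingular_translation[OF g, of _ 0 "-1"]) (simp add: const_0 const_1 const_uminus)
  ultimately show ?thesis
    using equisingular_along_self[OF g] by (simp add: es_ideal_def equisingular_def)
qed

lemma mult_singular:
  assumes f: "reduced_curve_singularity f"
  shows "mult f \<ge> 2"
proof (rule ccontr)
  assume "\<not> mult f \<ge> 2"
  have "f \<noteq> 0" using f by (simp add: reduced_curve_singularity_def curve_germ_def)
  then have "\<exists>m i j. i + j = m \<and> coef f i j \<noteq> 0"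
    by transfer (simp add: fps_eq_iff)
  then have "\<exists>i j. i + j = mult f \<and> coef f i j \<noteq> 0"
    unfolding mult_def by (rule LeastI_ex)
  then obtain i j where "i + j < 2" "coef f i j \<noteq> 0" using \<open>\<not> mult f \<ge> 2\<close> by force
  then have "coef f 0 0 \<noteq> 0 \<or> coef f 1 0 \<noteq> 0 \<or> coef f 0 1 \<noteq> 0"
    by (cases i; cases j) auto
  moreover have "coef (dx f) 0 0 = coef f 1 0" "coef (dy f) 0 0 = coef f 0 1"
    by (transfer; simp)+
  ultimately show False
    using f by (simp add: reduced_curve_singularity_def curve_germ_def)
qed

text \<open>
  The section of an equisingular family starts at the singular point, where the derivatives of
  \<open>f\<close>, and hence the translation of the section to the origin, contribute nothing to the
  constant term.
\<close>

lemma equisingular_vanishes: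
  assumes f: "reduced_curve_singularity f" and g: "equisingular f g"
  shows "coef g 0 0 = 0"
proof -
  have f0: "coef f 0 0 = 0" "coef (dx f) 0 0 = 0" "coef (dy f) 0 0 = 0"
    using f by (simp_all add: reduced_curve_singularity_def curve_germ_def)
  from g[unfolded equisingular_def] show ?thesis
  proof cases
    case resolved
    then show ?thesis using f0(1) mult_singular[OF f] by (simp add: resolved_def)
  next
    case (blow_up a b g' m f\<^sub>1 g\<^sub>1 f\<^sub>2 g\<^sub>2)
    then have "coef g' 0 0 = 0"
      using mult_singular[OF f] by (simp add: vanishes_to_order_def)
    with blow_up(3) show ?thesis by (simp add: coef_add coef_mult_0 f0)
  qed
qed

lemma const_inj: "inj const"
  by (rule injI) (metis coef_const)

text \<open>
  Every finite family is independent modulo the empty set, which contains no linear combination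
  at all.
\<close>

lemma codim_empty: "codim {} = \<infinity>"
proof (cases "codim {}")
  case (enat n)
  have "infinite (UNIV :: germ set)"
    using const_inj infinite_UNIV_char_0 by (metis finite_imageD finite_subset subset_UNIV)
  then obtain B :: "germ set" where "finite B" "card B = Suc n"
    using infinite_arbitrarily_large by blast
  then have "independent_mod {} B" by (simp add: independent_mod_def)
  from independent_mod_card_le[OF this] show ?thesis using enat \<open>card B = Suc n\<close> by simp
qed simp

theorem lemma2p2:
  fixes f :: germ
  assumes "reduced_curve_singularity f"
  shows "gamma_es f \<le> (ereal_of_enat (tau_es f) + 1)\<^sup>2 \<and>
         gamma_ea f \<le> (ereal_of_enat (tau f) + 1)\<^sup>2"
proof
  have f: "coef f 0 0 = 0" "coef (dx f) 0 0 = 0" "coef (dy f) 0 0 = 0"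
    using assms by (simp_all add: reduced_curve_singularity_def curve_germ_def)
  show "gamma_es f \<le> (ereal_of_enat (tau_es f) + 1)\<^sup>2"
  proof (cases "es_ideal f = {}")
    case True
    then show ?thesis by (simp add: tau_es_def codim_empty power2_eq_square)
  next
    case False
    then obtain g where "equisingular f g" by (auto simp: es_ideal_def)
    then show ?thesis
      unfolding gamma_es_def tau_es_def
      by (intro gamma_le f(1) tjurina_generators_equisingular)
         (auto simp: es_ideal_def equisingular_vanishes[OF assms])
  qed
  have "{f, dx f, dy f} \<subseteq> tjurina_ideal f"
    unfolding tjurina_ideal_def ideal_gen_def by (rule germ_module.span_superset)
  then show "gamma_ea f \<le> (ereal_of_enat (tau f) + 1)\<^sup>2"
    unfolding gamma_ea_def tau_def
    using f by (intro gamma_le) (auto simp: tjurina_ideal_def intro: ideal_gen_vanishing[rotated])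
qed

end
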